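(* Let $b'>0$ and suppose that $$\sum_{s=0}^\infty f_{W_q}(s)^{1/2}\Bigl(\frac{b'+1-q}{q}\Bigr)^s<\infty .$$ Then, for any $0<b<b'$, as $N\to\infty$, $$\bigl\{\sqrt N\,(\widehat f_W(w)-f_W(w))\bigr\}_{w\in\mathbb N}\to\{S(\xi)_w\}_{w\in\mathbb N}$$ in distribution in the space $l_{\infty,b}$, where $\xi=\{\xi_s\}_{s\in\mathbb N}$ is a zero-mean Gaussian process with $E\xi_{s_1}\xi_{s_2}=f_{W_q}(s_1)\delta_{s_1,s_2}-f_{W_q}(s_1)f_{W_q}(s_2)$ ($\delta$ is the Kronecker symbol).
   Context: $\mathbb N=\{1,2,\dots\}$, $q\in(0,1)$ is fixed. $W$ is a random variable with values in $\mathbb N$ and probability mass function $f_W(w)=P(W=w)$; given $W=w$, $W_q$ is Binomial$(w,q)$, and $f_{W_q}(s)=P(W_q=s)$, $s\ge0$. For a sequence $x=\{x_n\}_{n\in\mathbb N}$, $S(x)=\{S(x)_n\}_{n\in\mathbb N}$ is $$S(x)_n=\sum_{i=n}^\infty\binom{i}{n}\frac{(-1)^{i-n}}{q^i}(1-q)^{i-n}x_i,\qquad n\ge1$$ (for $\xi$, an almost surely convergent series). Let $W_{q,1},\dots,W_{q,N}$ be i.i.d. copies of $W_q$, $\widehat f_{W_q}(s)=\frac1N\sum_{k=1}^N1_{\{W_{q,k}=s\}}$, and $\widehat f_W(w)=S(\widehat f_{W_q})_w$, $w\ge1$ (a finite sum for each realization). For $a>0$, $$l_{\infty,a}=\Bigl\{x=\{x_n\}_{n\ge0}:\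 \|x\|_{\infty,a}:=\sup_{n\ge0}a^n|x_n|<\infty\Bigr\},$$ with the norm $\|\cdot\|_{\infty,a}$; a sequence indexed by $\mathbb N$ is regarded as an element of $l_{\infty,a}$ by setting its $0$th term equal to $0$. *)

theory Defs
  imports "HOL-Probability.Probability"
begin

definition pmass :: "'a measure \<Rightarrow> ('a \<Rightarrow> nat) \<Rightarrow> nat \<Rightarrow> real" where
  "pmass M X s = \<P>(\<omega> in M. X \<omega> = s)"

definition has_binomial_thinning :: "'a measure \<Rightarrow> real \<Rightarrow> ('a \<Rightarrow> nat) \<Rightarrow> ('a \<Rightarrow> nat) \<Rightarrow> bool" where
  "has_binomial_thinning M q W Wq \<longleftrightarrow>
     (\<forall>w s. pmass M W w > 0 \<longrightarrow>
        \<P>(\<omega> in M. Wq \<omega> = s \<bar> W \<omega> = w) = pmf (binomial_pmf w q) s)"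

definition iid_copies :: "'a measure \<Rightarrow> (nat \<Rightarrow> 'a \<Rightarrow> nat) \<Rightarrow> 'b measure \<Rightarrow> ('b \<Rightarrow> nat) \<Rightarrow> bool" where
  "iid_copies M X M0 X0 \<longleftrightarrow>
     prob_space.indep_vars M (\<lambda>_. count_space UNIV) X {1..} \<and>
     (\<forall>k\<ge>1. distr M (count_space UNIV) (X k) = distr M0 (count_space UNIV) X0)"

(* The summation index is j = i - n, so that i runs over n, n + 1, ... *)
definition S_term :: "real \<Rightarrow> (nat \<Rightarrow> real) \<Rightarrow> nat \<Rightarrow> nat \<Rightarrow> real" where
  "S_term q x n j = real ((n + j) choose n) * ((-1) ^ j / q ^ (n + j)) * (1 - q) ^ j * x (n + j)"

definition S_op :: "real \<Rightarrow> (nat \<Rightarrow> real) \<Rightarrow> nat \<Rightarrow> real" where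
  "S_op q x n = (\<Sum>j. S_term q x n j)"

definition emp_pmf :: "(nat \<Rightarrow> 'a \<Rightarrow> nat) \<Rightarrow> nat \<Rightarrow> 'a \<Rightarrow> nat \<Rightarrow> real" where
  "emp_pmf X N \<omega> s = (1 / real N) * (\<Sum>k=1..N. if X k \<omega> = s then 1 else 0)"

definition linf :: "real \<Rightarrow> (nat \<Rightarrow> real) set" where
  "linf a = {x. bdd_above (range (\<lambda>n. a ^ n * \<bar>x n\<bar>))}"

definition linf_norm :: "real \<Rightarrow> (nat \<Rightarrow> real) \<Rightarrow> real" where
  "linf_norm a x = (SUP n. a ^ n * \<bar>x n\<bar>)"

(* The value 0 off the space only serves the locale Metric_space, which asks for a
   distance that is nonnegative on the whole type. *)
definition linf_dist :: "real \<Rightarrow> (nat \<Rightarrow> real) \<Rightarrow> (nat \<Rightarrow> real) \<Rightarrow> real" where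
  "linf_dist a x y =
     (if x \<in> linf a \<and> y \<in> linf a then linf_norm a (\<lambda>n. x n - y n) else 0)"

definition linf_top :: "real \<Rightarrow> (nat \<Rightarrow> real) topology" where
  "linf_top a = Metric_space.mtopology (linf a) (linf_dist a)"

lemma linf_diff:
  assumes "a > 0" "x \<in> linf a" "y \<in> linf a"
  shows "(\<lambda>n. x n - y n) \<in> linf a"
proof -
  obtain A B where A: "\<And>n. a ^ n * \<bar>x n\<bar> \<le> A" and B: "\<And>n. a ^ n * \<bar>y n\<bar> \<le> B"
    using assms unfolding linf_def bdd_above_def by auto
  have "a ^ n * \<bar>x n - y n\<bar> \<le> A + B" for n
  proof -
    have "a ^ n * \<bar>x n - y n\<bar> \<le> a ^ n * (\<bar>x n\<bar> + \<bar>y n\<bar>)"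
      using assms(1) by (intro mult_left_mono) auto
    also have "\<dots> \<le> A + B"
      using A[of n] B[of n] by (simp add: distrib_left)
    finally show ?thesis .
  qed
  then show ?thesis unfolding linf_def bdd_above_def by auto
qed

lemma linf_norm_upper:
  assumes "x \<in> linf a"
  shows "a ^ n * \<bar>x n\<bar> \<le> linf_norm a x"
  using assms unfolding linf_norm_def linf_def by (auto intro: cSUP_upper)

lemma linf_norm_nonneg:
  assumes "x \<in> linf a"
  shows "0 \<le> linf_norm a x"
proof -
  have "0 \<le> a ^ 0 * \<bar>x 0\<bar>" by simp
  also have "\<dots> \<le> linf_norm a x" by (rule linf_norm_upper[OF assms])
  finally show ?thesis .
qed

lemma Metric_space_linf:
  assumes a: "a > 0"
  shows "Metric_space (linf a) (linf_dist a)"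
proof
  fix x y
  show "0 \<le> linf_dist a x y"
    by (simp add: linf_dist_def linf_norm_nonneg linf_diff[OF a])
next
  fix x y
  show "linf_dist a x y = linf_dist a y x"
    by (simp add: linf_dist_def linf_norm_def abs_minus_commute)
next
  fix x y assume xy: "x \<in> linf a" "y \<in> linf a"
  show "linf_dist a x y = 0 \<longleftrightarrow> x = y"
  proof
    assume "linf_dist a x y = 0"
    then have "a ^ n * \<bar>x n - y n\<bar> \<le> 0" for n
      using linf_norm_upper[OF linf_diff[OF a xy], of n] xy by (simp add: linf_dist_def)
    then have "x n = y n" for n
      using zero_less_power[OF a, of n] by (metis abs_le_zero_iff eq_iff_diff_eq_0 mult_le_0_iff not_le)
    then show "x = y" by blast
  next
    assume "x = y"
    then show "linf_dist a x y = 0"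
      by (simp add: linf_dist_def linf_norm_def)
  qed
next
  fix x y z assume xyz: "x \<in> linf a" "y \<in> linf a" "z \<in> linf a"
  have "linf_norm a (\<lambda>n. x n - z n) \<le> linf_norm a (\<lambda>n. x n - y n) + linf_norm a (\<lambda>n. y n - z n)"
    unfolding linf_norm_def[of a "\<lambda>n. x n - z n"]
  proof (rule cSUP_least)
    fix n
    have "a ^ n * \<bar>x n - z n\<bar> \<le> a ^ n * (\<bar>x n - y n\<bar> + \<bar>y n - z n\<bar>)"
      using a by (intro mult_left_mono) auto
    also have "\<dots> \<le> linf_norm a (\<lambda>n. x n - y n) + linf_norm a (\<lambda>n. y n - z n)"
      using linf_norm_upper[OF linf_diff[OF a xyz(1,2)], of n]
        linf_norm_upper[OF linf_diff[OF a xyz(2,3)], of n]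
      by (simp add: distrib_left)
    finally show "a ^ n * \<bar>x n - z n\<bar> \<le> \<dots>" .
  qed simp
  then show "linf_dist a x z \<le> linf_dist a x y + linf_dist a y z"
    using xyz by (simp add: linf_dist_def)
qed

definition borel_of :: "'s topology \<Rightarrow> 's measure" where
  "borel_of T = sigma (topspace T) {U. openin T U}"

definition tends_in_distribution ::
    "'s topology \<Rightarrow> 'a measure \<Rightarrow> (nat \<Rightarrow> 'a \<Rightarrow> 's) \<Rightarrow> 'b measure \<Rightarrow> ('b \<Rightarrow> 's) \<Rightarrow> bool" where
  "tends_in_distribution T M X M' Y \<longleftrightarrow>
     (\<forall>N. X N \<in> measurable M (borel_of T)) \<and>
     Y \<in> measurable M' (borel_of T) \<and>
     (\<forall>g :: 's \<Rightarrow> real. continuous_map T euclideanreal g \<and> bounded (g ` topspace T) \<longrightarrow>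
        (\<lambda>N. LINT \<omega>|M. g (X N \<omega>)) \<longlonglongrightarrow> (LINT \<omega>|M'. g (Y \<omega>)))"

(* Degenerate normal laws are admitted: the covariances in use can be singular. *)
definition is_gaussian :: "'a measure \<Rightarrow> ('a \<Rightarrow> real) \<Rightarrow> bool" where
  "is_gaussian M X \<longleftrightarrow> X \<in> borel_measurable M \<and>
     (\<exists>\<mu> \<sigma>. (\<sigma> = 0 \<and> (AE \<omega> in M. X \<omega> = \<mu>)) \<or>
             (\<sigma> > 0 \<and> distributed M lborel X (normal_density \<mu> \<sigma>)))"

definition gaussian_process :: "'a measure \<Rightarrow> 'i set \<Rightarrow> ('i \<Rightarrow> 'a \<Rightarrow> real) \<Rightarrow> bool" where
  "gaussian_process M I \<xi> \<longleftrightarrow>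
     (\<forall>F c. finite F \<and> F \<subseteq> I \<longrightarrow> is_gaussian M (\<lambda>\<omega>. \<Sum>i\<in>F. c i * \<xi> i \<omega>))"

end

theory Submission
  imports Defs
begin

text \<open>With \<open>z = (b' + 1 - q) / q\<close>, the binomial theorem shows that \<open>S\<close> is a contraction from the
  weighted space of sequences with \<open>\<Sum>s. z ^ s * \<bar>x s\<bar> < \<infinity>\<close> into \<open>l\<^sub>\<infinity>\<^sub>,\<^sub>b\<close>, and \<open>S\<close> maps the law of
  \<open>W\<^sub>q\<close> to that of \<open>W\<close>. So the theorem reduces to a central limit theorem for the empirical
  process \<open>V N\<close> in the weighted space. There \<open>E \<bar>V N s\<bar> \<le> sqrt (f s)\<close>, and the summability
  hypothesis makes the tails negligible uniformly in \<open>N\<close>, which leaves finitely many coordinates.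
  Those are handled by the one-dimensional central limit theorem for linear combinations and by
  Stone-Weierstrass approximation with trigonometric sums. Since \<open>l\<^sub>\<infinity>\<^sub>,\<^sub>b\<close> is not separable,
  measurability and general test functions are reached through Lipschitz functions only.\<close>

subsection \<open>Lipschitz regularisation in metric spaces\<close>

text \<open>The square root in the summability hypothesis is Cauchy-Schwarz: the fluctuation at
  \<open>s\<close> has variance at most \<open>f s\<close>. The hypothesis thus bounds the expected
  weighted norm uniformly in \<open>N\<close>, and the same estimate places the Gaussian limit in
  the weighted space almost surely. Coordinatewise convergence alone would not suffice, because
  \<open>S\<close> reads infinitely many coordinates with growing coefficients and is not continuous
  for it. In the weighted norm \<open>S\<close> is Lipschitz, so Lipschitz test functions pull back
  to Lipschitz functionals of the fluctuations. Coordinate 0 needs care: \<open>\<xi>\<close> is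
  given only from index 1 on, while the empirical distribution also fluctuates at 0. Since
  \<open>S(x)_n\<close> with \<open>n \<ge> 1\<close> never reads \<open>x_0\<close>, both sequences
  are set to 0 there.\<close>

definition inf_conv :: "'s set \<Rightarrow> ('s \<Rightarrow> 's \<Rightarrow> real) \<Rightarrow> real \<Rightarrow> ('s \<Rightarrow> real) \<Rightarrow> 's \<Rightarrow> real" where
  "inf_conv A d k g x = (INF y\<in>A. g y + k * d x y)"

context Metric_space
begin

lemma inf_conv_bdd_below:
  assumes "\<And>y. y \<in> M \<Longrightarrow> \<bar>g y\<bar> \<le> B" "k \<ge> 0"
  shows "bdd_below ((\<lambda>y. g y + k * d x y) ` M)"
proof (rule bdd_belowI2)
  fix y assume "y \<in> M"
  then show "- B \<le> g y + k * d x y"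
    using assms(1)[of y] mult_nonneg_nonneg[OF assms(2) nonneg[of x y]] by linarith
qed

lemma inf_conv_le:
  assumes "\<And>y. y \<in> M \<Longrightarrow> \<bar>g y\<bar> \<le> B" "k \<ge> 0" "x \<in> M"
  shows "inf_conv M d k g x \<le> g x"
  unfolding inf_conv_def
  by (rule cINF_lower2[OF inf_conv_bdd_below[OF assms(1,2)], of _ x])
    (use assms(3) in auto)

lemma inf_conv_abs_le:
  assumes "\<And>y. y \<in> M \<Longrightarrow> \<bar>g y\<bar> \<le> B" "k \<ge> 0" "x \<in> M"
  shows "\<bar>inf_conv M d k g x\<bar> \<le> B"
proof -
  have "- B \<le> inf_conv M d k g x"
    unfolding inf_conv_def
  proof (rule cINF_greatest)
    fix y assume "y \<in> M"
    then show "- B \<le> g y + k * d x y"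
      using assms(1)[of y] mult_nonneg_nonneg[OF assms(2) nonneg[of x y]] by linarith
  qed (use assms(3) in auto)
  moreover have "inf_conv M d k g x \<le> g x" by (rule inf_conv_le[OF assms])
  ultimately show ?thesis using assms(1)[OF assms(3)] by linarith
qed

text \<open>\<open>inf_conv\<close> is the Pasch-Hausdorff envelope: as a function of
  \<open>x\<close> it is an infimum of functions that are \<open>k\<close>-Lipschitz by the triangle
  inequality, and a finite infimum of such functions is again \<open>k\<close>-Lipschitz.\<close>

lemma inf_conv_lipschitz:
  assumes g: "\<And>y. y \<in> M \<Longrightarrow> \<bar>g y\<bar> \<le> B" and k: "k \<ge> 0" and x: "x \<in> M" "x' \<in> M"
  shows "\<bar>inf_conv M d k g x - inf_conv M d k g x'\<bar> \<le> k * d x x'"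
proof -
  have *: "inf_conv M d k g u \<le> inf_conv M d k g v + k * d u v" if uv: "u \<in> M" "v \<in> M" for u v
  proof -
    have "inf_conv M d k g u - k * d u v \<le> inf_conv M d k g v"
      unfolding inf_conv_def[of _ _ _ _ v]
    proof (rule cINF_greatest)
      fix y assume y: "y \<in> M"
      have "inf_conv M d k g u \<le> g y + k * d u y"
        unfolding inf_conv_def by (rule cINF_lower[OF inf_conv_bdd_below[OF g k] y])
      also have "\<dots> \<le> g y + k * (d u v + d v y)"
        using triangle[OF uv y] k by (intro add_left_mono mult_left_mono) auto
      finally show "inf_conv M d k g u - k * d u v \<le> g y + k * d v y"
        by (simp add: algebra_simps)
    qed (use x in auto)
    then show ?thesis by linarith
  qed
  show ?thesis using *[OF x] *[OF x(2,1)] commute[of x x'] by (simp add: abs_le_iff)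
qed

text \<open>Near \<open>x\<close> lower semicontinuity bounds \<open>g y\<close> from below; farther
  away the penalty \<open>k * d x y\<close> takes over. The condition on \<open>g\<close> is
  one-sided so that indicators of open sets qualify.\<close>

lemma inf_conv_tendsto:
  assumes g: "\<And>y. y \<in> M \<Longrightarrow> \<bar>g y\<bar> \<le> B" and x: "x \<in> M"
    and lsc: "\<And>e. e > 0 \<Longrightarrow> \<exists>\<delta>>0. \<forall>y\<in>M. d x y < \<delta> \<longrightarrow> g x - e < g y"
  shows "(\<lambda>k. inf_conv M d (real k) g x) \<longlonglongrightarrow> g x"
proof (rule tendstoI)
  fix e :: real assume e: "e > 0"
  from lsc[of "e/2"] e obtain \<delta> where \<delta>: "\<delta> > 0"
    and near: "\<And>y. y \<in> M \<Longrightarrow> d x y < \<delta> \<Longrightarrow> g x - e / 2 < g y" by auto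
  \<comment> \<open>\<open>2 * B\<close> bounds the oscillation of \<open>g\<close>, so from
    \<open>K\<close> on the penalty at distance \<open>\<delta>\<close> outweighs any drop of
    \<open>g\<close>.\<close>
  obtain K :: nat where K: "2 * B / \<delta> \<le> real K" using real_arch_simple by blast
  have "dist (inf_conv M d (real k) g x) (g x) < e" if k: "k \<ge> K" for k
  proof -
    have "g x - e / 2 \<le> inf_conv M d (real k) g x"
      unfolding inf_conv_def
    proof (rule cINF_greatest)
      fix y assume y: "y \<in> M"
      show "g x - e / 2 \<le> g y + real k * d x y"
      proof (cases "d x y < \<delta>")
        case True
        have "0 \<le> real k * d x y" by simp
        then show ?thesis using near[OF y True] by linarith
      next
        case False
        have "2 * B \<le> real K * \<delta>" using K \<delta> by (simp add: field_simps)
        also have "\<dots> \<le> real k * d x y" using k False \<delta> by (intro mult_mono) auto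
        finally show ?thesis using g[OF x] g[OF y] e by linarith
      qed
    qed (use x in auto)
    moreover have "inf_conv M d (real k) g x \<le> g x" by (rule inf_conv_le[OF g _ x]) auto
    ultimately show ?thesis using e by (simp add: dist_real_def)
  qed
  then show "\<forall>\<^sub>F k in sequentially. dist (inf_conv M d (real k) g x) (g x) < e"
    unfolding eventually_sequentially by blast
qed

text \<open>A bounded lower semicontinuous function is the increasing limit of its Lipschitz
  regularisations, so Lipschitz test functions suffice both for Borel measurability (take the
  indicator of an open set) and for convergence in distribution; no separability is needed.\<close>

lemma measurable_borel_of_if_lipschitz:
  assumes maps: "Y \<in> space \<Omega> \<rightarrow> M"
    and lip: "\<And>h L B. L \<ge> 0 \<Longrightarrow> (\<And>x y. x \<in> M \<Longrightarrow> y \<in> M \<Longrightarrow> \<bar>h x - h y\<bar> \<le> L * d x y) \<Longrightarrow>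
                 (\<And>x. x \<in> M \<Longrightarrow> \<bar>h x\<bar> \<le> B) \<Longrightarrow> (\<lambda>\<omega>. h (Y \<omega>) :: real) \<in> borel_measurable \<Omega>"
  shows "Y \<in> measurable \<Omega> (borel_of mtopology)"
  unfolding borel_of_def
proof (rule measurable_measure_of)
  show "{U. openin mtopology U} \<subseteq> Pow (topspace mtopology)"
    using openin_subset[of mtopology] by auto
  show "Y \<in> space \<Omega> \<rightarrow> topspace mtopology" using maps by simp
  fix U assume "U \<in> {U. openin mtopology U}"
  then have U: "openin mtopology U" by simp
  let ?g = "indicator U :: _ \<Rightarrow> real"
  have bd: "\<bar>?g y\<bar> \<le> 1" for y by (auto simp: indicator_def)
  have lim: "(\<lambda>k. inf_conv M d (real k) ?g (Y \<omega>)) \<longlonglongrightarrow> ?g (Y \<omega>)" if "\<omega> \<in> space \<Omega>" for \<omega>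
  proof (rule inf_conv_tendsto[OF bd])
    show Y: "Y \<omega> \<in> M" using maps that by auto
    fix e :: real assume e: "e > 0"
    show "\<exists>\<delta>>0. \<forall>y\<in>M. d (Y \<omega>) y < \<delta> \<longrightarrow> ?g (Y \<omega>) - e < ?g y"
    proof (cases "Y \<omega> \<in> U")
      case True
      then obtain r where r: "r > 0" "mball (Y \<omega>) r \<subseteq> U"
        using U unfolding openin_mtopology by blast
      then show ?thesis using e True Y
        by (intro exI[of _ r]) (auto simp: subset_iff indicator_def)
    next
      case False
      then show ?thesis using e by (intro exI[of _ 1]) (auto simp: indicator_def)
    qed
  qed
  have "(\<lambda>\<omega>. ?g (Y \<omega>)) \<in> borel_measurable \<Omega>"
  proof (rule borel_measurable_LIMSEQ_real[OF lim])
    fix k show "(\<lambda>\<omega>. inf_conv M d (real k) ?g (Y \<omega>)) \<in> borel_measurable \<Omega>"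
      by (rule lip[of "real k" _ 1])
        (auto intro!: inf_conv_lipschitz[OF bd] inf_conv_abs_le[OF bd])
  qed
  then have "(\<lambda>\<omega>. ?g (Y \<omega>)) -` {1} \<inter> space \<Omega> \<in> sets \<Omega>" by (rule measurable_sets) simp
  also have "(\<lambda>\<omega>. ?g (Y \<omega>)) -` {1} \<inter> space \<Omega> = Y -` U \<inter> space \<Omega>"
    by (auto simp: indicator_def)
  finally show "Y -` U \<inter> space \<Omega> \<in> sets \<Omega>" .
qed

lemma tends_in_distribution_if_lipschitz:
  assumes P: "prob_space P" and P': "prob_space P'"
    and X: "\<And>N. X N \<in> space P \<rightarrow> M" and Y: "Y \<in> space P' \<rightarrow> M"
    and mX: "\<And>N h L B. L \<ge> 0 \<Longrightarrow> (\<And>x y. x \<in> M \<Longrightarrow> y \<in> M \<Longrightarrow> \<bar>h x - h y\<bar> \<le> L * d x y) \<Longrightarrow>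
                 (\<And>x. x \<in> M \<Longrightarrow> \<bar>h x\<bar> \<le> B) \<Longrightarrow> (\<lambda>\<omega>. h (X N \<omega>) :: real) \<in> borel_measurable P"
    and mY: "\<And>h L B. L \<ge> 0 \<Longrightarrow> (\<And>x y. x \<in> M \<Longrightarrow> y \<in> M \<Longrightarrow> \<bar>h x - h y\<bar> \<le> L * d x y) \<Longrightarrow>
                 (\<And>x. x \<in> M \<Longrightarrow> \<bar>h x\<bar> \<le> B) \<Longrightarrow> (\<lambda>\<omega>. h (Y \<omega>) :: real) \<in> borel_measurable P'"
    and conv: "\<And>h L B. L \<ge> 0 \<Longrightarrow> (\<And>x y. x \<in> M \<Longrightarrow> y \<in> M \<Longrightarrow> \<bar>h x - h y\<bar> \<le> L * d x y) \<Longrightarrow>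
                 (\<And>x. x \<in> M \<Longrightarrow> \<bar>h x\<bar> \<le> B) \<Longrightarrow>
                 (\<lambda>N. LINT \<omega>|P. (h (X N \<omega>) :: real)) \<longlonglongrightarrow> (LINT \<omega>|P'. h (Y \<omega>))"
  shows "tends_in_distribution mtopology P X P' Y"
proof -
  interpret P: prob_space P by fact
  interpret P': prob_space P' by fact
  have bX: "X N \<in> measurable P (borel_of mtopology)" for N
    by (rule measurable_borel_of_if_lipschitz[OF X mX])
  have bY: "Y \<in> measurable P' (borel_of mtopology)"
    by (rule measurable_borel_of_if_lipschitz[OF Y mY])
  \<comment> \<open>The lim inf half: the regularisations lie below \<open>g\<close>, so one
    \<open>k\<close> is fixed by dominated convergence under the law of \<open>Y\<close>, and only
    then does \<open>N\<close> tend to infinity.\<close>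
  have lower: "\<forall>\<^sub>F N in sequentially. (LINT \<omega>|P'. g (Y \<omega>)) - e < (LINT \<omega>|P. g (X N \<omega>))"
    if g: "continuous_map mtopology euclideanreal g" and bd: "\<And>y. y \<in> M \<Longrightarrow> \<bar>g y\<bar> \<le> B"
      and e: "e > 0" for g B and e :: real
  proof -
    let ?g = "\<lambda>k. inf_conv M d (real k) g"
    have lim: "(\<lambda>k. ?g k x) \<longlonglongrightarrow> g x" if x: "x \<in> M" for x
    proof (rule inf_conv_tendsto[OF bd x])
      fix e :: real assume e: "e > 0"
      have "openin mtopology {y \<in> topspace mtopology. g y \<in> {g x - e<..}}"
        by (rule openin_continuous_map_preimage[OF g]) auto
      moreover have "x \<in> {y \<in> topspace mtopology. g y \<in> {g x - e<..}}" using x e by simp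
      ultimately obtain r where r: "r > 0" "mball x r \<subseteq> {y \<in> topspace mtopology. g y \<in> {g x - e<..}}"
        unfolding openin_mtopology by meson
      then show "\<exists>\<delta>>0. \<forall>y\<in>M. d x y < \<delta> \<longrightarrow> g x - e < g y"
        using x by (intro exI[of _ r]) (auto simp: subset_iff)
    qed
    have abs: "\<bar>?g k x\<bar> \<le> B" if "x \<in> M" for k x
      by (rule inf_conv_abs_le[OF bd _ that]) auto
    have below: "?g k x \<le> g x" if "x \<in> M" for k x
      by (rule inf_conv_le[OF bd _ that]) auto
    have mgX: "(\<lambda>\<omega>. ?g k (X N \<omega>)) \<in> borel_measurable P" for k N
      by (rule mX[of "real k" _ B])
        (use abs in \<open>auto intro!: inf_conv_lipschitz[OF bd]\<close>)
    have mgY: "(\<lambda>\<omega>. ?g k (Y \<omega>)) \<in> borel_measurable P'" for k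
      by (rule mY[of "real k" _ B])
        (auto intro!: inf_conv_lipschitz[OF bd] inf_conv_abs_le[OF bd])
    have mX': "(\<lambda>\<omega>. g (X N \<omega>)) \<in> borel_measurable P" for N
      by (rule borel_measurable_LIMSEQ_real[OF lim mgX]) (use X in auto)
    have mY': "(\<lambda>\<omega>. g (Y \<omega>)) \<in> borel_measurable P'"
      by (rule borel_measurable_LIMSEQ_real[OF lim mgY]) (use Y in auto)
    have "(\<lambda>k. LINT \<omega>|P'. ?g k (Y \<omega>)) \<longlonglongrightarrow> (LINT \<omega>|P'. g (Y \<omega>))"
      by (rule integral_dominated_convergence[where w="\<lambda>_. B", OF mY' mgY])
        (use lim Y abs in \<open>auto intro!: AE_I2 simp: Pi_iff\<close>)
    then have "\<forall>\<^sub>F k in sequentially. (LINT \<omega>|P'. g (Y \<omega>)) - e < (LINT \<omega>|P'. ?g k (Y \<omega>))"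
      using e by (intro order_tendstoD) auto
    then obtain k where k: "(LINT \<omega>|P'. g (Y \<omega>)) - e < (LINT \<omega>|P'. ?g k (Y \<omega>))"
      using eventually_happens by force
    have "(\<lambda>N. LINT \<omega>|P. ?g k (X N \<omega>)) \<longlonglongrightarrow> (LINT \<omega>|P'. ?g k (Y \<omega>))"
      by (rule conv[of "real k" _ B])
        (auto intro!: inf_conv_lipschitz[OF bd] inf_conv_abs_le[OF bd])
    then have "\<forall>\<^sub>F N in sequentially. (LINT \<omega>|P'. g (Y \<omega>)) - e < (LINT \<omega>|P. ?g k (X N \<omega>))"
      using k by (rule order_tendstoD)
    moreover have "(LINT \<omega>|P. ?g k (X N \<omega>)) \<le> (LINT \<omega>|P. g (X N \<omega>))" for N
    proof (rule integral_mono)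
      show "integrable P (\<lambda>\<omega>. ?g k (X N \<omega>))"
        by (rule P.integrable_const_bound[of _ B, OF _ mgX])
          (use X abs in \<open>auto intro!: AE_I2 simp: Pi_iff\<close>)
      show "integrable P (\<lambda>\<omega>. g (X N \<omega>))"
        by (rule P.integrable_const_bound[of _ B, OF _ mX'])
          (use X bd in \<open>auto intro!: AE_I2 simp: Pi_iff\<close>)
    qed (use X below in auto)
    ultimately show ?thesis
      by (auto elim!: eventually_mono intro: less_le_trans)
  qed
  have "(\<lambda>N. LINT \<omega>|P. g (X N \<omega>)) \<longlonglongrightarrow> (LINT \<omega>|P'. g (Y \<omega>))"
    if g: "continuous_map mtopology euclideanreal g" and "bounded (g ` topspace mtopology)" for g
  proof -
    from that obtain B where B: "\<And>y. y \<in> M \<Longrightarrow> \<bar>g y\<bar> \<le> B" by (auto simp: bounded_real)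
    \<comment> \<open>Applied to \<open>-g\<close>, the lower bound becomes the lim sup
      half.\<close>
    have g': "continuous_map mtopology euclideanreal (\<lambda>x. - g x)"
      using g by (rule continuous_map_minus)
    show ?thesis
    proof (rule tendstoI)
      fix e :: real assume e: "e > 0"
      have "\<forall>\<^sub>F N in sequentially. (LINT \<omega>|P'. g (Y \<omega>)) - e < (LINT \<omega>|P. g (X N \<omega>))"
        by (rule lower[OF g B e])
      moreover have "\<forall>\<^sub>F N in sequentially. (LINT \<omega>|P'. - g (Y \<omega>)) - e < (LINT \<omega>|P. - g (X N \<omega>))"
        by (rule lower[OF g' _ e]) (use B in auto)
      ultimately show "\<forall>\<^sub>F N in sequentially. dist (LINT \<omega>|P. g (X N \<omega>)) (LINT \<omega>|P'. g (Y \<omega>)) < e"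
        by eventually_elim (simp add: dist_real_def abs_less_iff)
    qed
  qed
  with bX bY show ?thesis unfolding tends_in_distribution_def by blast
qed

end

subsection \<open>Convergence in distribution in weighted sequence spaces\<close>

definition weighted_l1 :: "(nat \<Rightarrow> real) \<Rightarrow> (nat \<Rightarrow> real) set" where
  "weighted_l1 w = {x. summable (\<lambda>s. w s * \<bar>x s\<bar>)}"

text \<open>The class into which Lipschitz test functions on \<open>linf b\<close> fall once
  composed with \<open>S_op\<close>. The distance is a series, so the inequality is asked only on
  \<open>weighted_l1 w\<close>, where it converges for nonnegative weights.\<close>

definition lipschitz_l1 :: "(nat \<Rightarrow> real) \<Rightarrow> real \<Rightarrow> ((nat \<Rightarrow> real) \<Rightarrow> real) \<Rightarrow> bool" where
  "lipschitz_l1 w L h \<longleftrightarrow> L \<ge> 0 \<and>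
     (\<forall>x\<in>weighted_l1 w. \<forall>y\<in>weighted_l1 w. \<bar>h x - h y\<bar> \<le> L * (\<Sum>s. w s * \<bar>x s - y s\<bar>))"

text \<open>A projection to \<open>m\<close> coordinates that keeps the type of sequences, so that
  one functional applies to a sequence and to its truncation.\<close>

definition trunc :: "nat \<Rightarrow> (nat \<Rightarrow> real) \<Rightarrow> nat \<Rightarrow> real" where
  "trunc m x = (\<lambda>s. if s < m then x s else 0)"

lemma lipschitz_l1D:
  assumes "lipschitz_l1 w L h" "x \<in> weighted_l1 w" "y \<in> weighted_l1 w"
  shows "\<bar>h x - h y\<bar> \<le> L * (\<Sum>s. w s * \<bar>x s - y s\<bar>)"
  using assms unfolding lipschitz_l1_def by blast

lemma trunc_in_weighted_l1: "trunc m x \<in> weighted_l1 w"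
  unfolding weighted_l1_def mem_Collect_eq
  by (rule summable_finite[of "{..<m}"]) (auto simp: trunc_def)

lemma lipschitz_l1_trunc:
  assumes h: "lipschitz_l1 w L h"
  shows "\<bar>h (trunc m x) - h (trunc m y)\<bar> \<le> L * (\<Sum>s<m. w s * \<bar>x s - y s\<bar>)"
proof -
  have "(\<Sum>s. w s * \<bar>trunc m x s - trunc m y s\<bar>) = (\<Sum>s<m. w s * \<bar>trunc m x s - trunc m y s\<bar>)"
    by (rule suminf_finite) (auto simp: trunc_def)
  also have "\<dots> = (\<Sum>s<m. w s * \<bar>x s - y s\<bar>)" by (intro sum.cong) (auto simp: trunc_def)
  finally show ?thesis
    using lipschitz_l1D[OF h trunc_in_weighted_l1 trunc_in_weighted_l1, of m x m y] by simp
qed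

lemma lipschitz_l1_trunc_tail:
  assumes h: "lipschitz_l1 w L h" and x: "x \<in> weighted_l1 w"
  shows "\<bar>h x - h (trunc m x)\<bar> \<le> L * (\<Sum>s. w (s + m) * \<bar>x (s + m)\<bar>)"
proof -
  have eq: "w s * \<bar>x s - trunc m x s\<bar> = (if s < m then 0 else w s * \<bar>x s\<bar>)" for s
    by (auto simp: trunc_def)
  have "summable (\<lambda>s. w (s + m) * \<bar>x (s + m)\<bar>)"
    using x summable_ignore_initial_segment unfolding weighted_l1_def by fastforce
  then have "summable (\<lambda>s. w s * \<bar>x s - trunc m x s\<bar>)"
    by (subst summable_iff_shift[symmetric, of _ m]) (simp add: eq)
  then have "(\<Sum>s. w s * \<bar>x s - trunc m x s\<bar>) = (\<Sum>s. w (s + m) * \<bar>x (s + m)\<bar>)"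
    by (subst suminf_split_initial_segment[of _ m]) (auto simp: eq)
  then show ?thesis
    using lipschitz_l1D[OF h x trunc_in_weighted_l1, of m x] by simp
qed

text \<open>Continuity is meant in the product topology, the one that fits coordinatewise
  measurability and compact cubes. A functional that is Lipschitz for the weighted norm need not be
  continuous there, but on \<open>m\<close> coordinates the weighted distance is a finite sum of
  functions of single coordinates.\<close>

lemma continuous_on_lipschitz_l1_trunc:
  assumes h: "lipschitz_l1 w L h"
  shows "continuous_on UNIV (\<lambda>x. h (trunc m x))"
  unfolding continuous_on_def
proof
  fix x :: "nat \<Rightarrow> real"
  have co: "((\<lambda>y. y s) \<longlongrightarrow> x s) (at x)" for s
    using continuous_on_product_coordinates[of s] unfolding continuous_on_def by auto
  have "((\<lambda>y. L * (\<Sum>s<m. w s * \<bar>y s - x s\<bar>)) \<longlongrightarrow> L * (\<Sum>s<m. w s * \<bar>x s - x s\<bar>)) (at x)"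
    by (intro tendsto_intros co)
  then have "((\<lambda>y. L * (\<Sum>s<m. w s * \<bar>y s - x s\<bar>)) \<longlongrightarrow> 0) (at x)" by simp
  then have "((\<lambda>y. h (trunc m y) - h (trunc m x)) \<longlongrightarrow> 0) (at x)"
    by (rule Lim_null_comparison[rotated]) (use lipschitz_l1_trunc[OF h] in simp)
  then show "((\<lambda>y. h (trunc m y)) \<longlongrightarrow> h (trunc m x)) (at x)"
    by (simp add: LIM_zero_iff)
qed

text \<open>The truncations are continuous for the product topology, hence measurable, and
  \<open>h\<close> is their pointwise limit on the weighted space because the tails of a convergent
  series vanish.\<close>

lemma measurable_lipschitz_l1:
  assumes h: "lipschitz_l1 w L h"
    and V: "\<And>s. (\<lambda>\<omega>. V \<omega> s) \<in> borel_measurable P"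
    and l1: "\<And>\<omega>. \<omega> \<in> space P \<Longrightarrow> V \<omega> \<in> weighted_l1 w"
  shows "(\<lambda>\<omega>. h (trunc m (V \<omega>))) \<in> borel_measurable P"
    and "(\<lambda>\<omega>. h (V \<omega>)) \<in> borel_measurable P"
proof -
  have V': "V \<in> borel_measurable P"
    by (rule measurable_coordinatewise_then_product[OF V])
  show tr: "(\<lambda>\<omega>. h (trunc m (V \<omega>))) \<in> borel_measurable P" for m
    using measurable_compose[OF V' borel_measurable_continuous_onI[OF continuous_on_lipschitz_l1_trunc[OF h]]] .
  show "(\<lambda>\<omega>. h (V \<omega>)) \<in> borel_measurable P"
  proof (rule borel_measurable_LIMSEQ_real[OF _ tr])
    fix \<omega> assume "\<omega> \<in> space P"
    then have x: "V \<omega> \<in> weighted_l1 w" by (rule l1)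
    have "(\<lambda>m. L * (\<Sum>s. w (s + m) * \<bar>V \<omega> (s + m)\<bar>)) \<longlonglongrightarrow> L * 0"
      using x unfolding weighted_l1_def
      by (intro tendsto_intros suminf_exist_split2) auto
    then have lim: "(\<lambda>m. L * (\<Sum>s. w (s + m) * \<bar>V \<omega> (s + m)\<bar>)) \<longlonglongrightarrow> 0" by simp
    have "(\<lambda>m. h (trunc m (V \<omega>)) - h (V \<omega>)) \<longlonglongrightarrow> 0"
      by (rule Lim_null_comparison[OF _ lim])
        (use lipschitz_l1_trunc_tail[OF h x] in \<open>simp add: abs_minus_commute\<close>)
    then show "(\<lambda>m. h (trunc m (V \<omega>))) \<longlonglongrightarrow> h (V \<omega>)" by (simp add: LIM_zero_iff)
  qed
qed

text \<open>Nonnegativity of the variance of \<open>\<bar>X\<bar>\<close>. In the application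
  \<open>c\<close> is \<open>sqrt (f s)\<close>.\<close>

lemma (in prob_space) expectation_abs_le:
  fixes X :: "'a \<Rightarrow> real"
  assumes X[measurable]: "X \<in> borel_measurable M" and sq: "integrable M (\<lambda>\<omega>. (X \<omega>)\<^sup>2)"
    and le: "expectation (\<lambda>\<omega>. (X \<omega>)\<^sup>2) \<le> c\<^sup>2" and c: "c \<ge> 0"
  shows "integrable M X" "expectation (\<lambda>\<omega>. \<bar>X \<omega>\<bar>) \<le> c"
proof -
  show int: "integrable M X" by (rule square_integrable_imp_integrable[OF X sq])
  have "0 \<le> variance (\<lambda>\<omega>. \<bar>X \<omega>\<bar>)" by simp
  also have "\<dots> = expectation (\<lambda>\<omega>. \<bar>X \<omega>\<bar>\<^sup>2) - (expectation (\<lambda>\<omega>. \<bar>X \<omega>\<bar>))\<^sup>2"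
    by (rule variance_eq) (use int sq in auto)
  finally have "(expectation (\<lambda>\<omega>. \<bar>X \<omega>\<bar>))\<^sup>2 \<le> c\<^sup>2" using le by simp
  then show "expectation (\<lambda>\<omega>. \<bar>X \<omega>\<bar>) \<le> c" using c by (rule power2_le_imp_le)
qed

text \<open>Uniformity in \<open>N\<close> rests here: the bound depends on the law of
  \<open>X\<close> through \<open>\<sigma>\<close> alone, and it is the tail of a convergent
  series.\<close>

lemma (in prob_space) expectation_tail_le:
  assumes X: "\<And>s. (\<lambda>\<omega>. X \<omega> s) \<in> borel_measurable M"
    and sq: "\<And>s. integrable M (\<lambda>\<omega>. (X \<omega> s)\<^sup>2)"
    and var: "\<And>s. expectation (\<lambda>\<omega>. (X \<omega> s)\<^sup>2) \<le> (\<sigma> s)\<^sup>2"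
    and \<sigma>: "\<And>s. \<sigma> s \<ge> 0" and w: "\<And>s. w s \<ge> 0" and summ: "summable (\<lambda>s. w s * \<sigma> s)"
    and l1: "AE \<omega> in M. X \<omega> \<in> weighted_l1 w"
  shows "integrable M (\<lambda>\<omega>. \<Sum>s. w (s + m) * \<bar>X \<omega> (s + m)\<bar>)"
    and "expectation (\<lambda>\<omega>. \<Sum>s. w (s + m) * \<bar>X \<omega> (s + m)\<bar>) \<le> (\<Sum>s. w (s + m) * \<sigma> (s + m))"
proof -
  let ?f = "\<lambda>s \<omega>. w (s + m) * \<bar>X \<omega> (s + m)\<bar>"
  note abs = expectation_abs_le[OF X sq var \<sigma>]
  have int: "integrable M (?f s)" for s using abs(1) by simp
  have le: "expectation (?f s) \<le> w (s + m) * \<sigma> (s + m)" for s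
    using abs(2)[of "s + m"] w by (auto intro: mult_left_mono)
  have summ': "summable (\<lambda>s. w (s + m) * \<sigma> (s + m))"
    by (rule summable_ignore_initial_segment[OF summ])
  have norm: "norm (?f s \<omega>) = ?f s \<omega>" for s \<omega> using w by simp
  have 1: "AE \<omega> in M. summable (\<lambda>s. norm (?f s \<omega>))"
    using l1
  proof eventually_elim
    case (elim \<omega>)
    then have "summable (\<lambda>s. w s * \<bar>X \<omega> s\<bar>)" by (simp add: weighted_l1_def)
    from summable_ignore_initial_segment[OF this, of m] show ?case by (simp only: norm)
  qed
  have 2: "summable (\<lambda>s. expectation (\<lambda>\<omega>. norm (?f s \<omega>)))"
    unfolding norm
    by (rule summable_comparison_test'[OF summ', of 0]) (use le w in \<open>auto intro!: integral_nonneg\<close>)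
  show "integrable M (\<lambda>\<omega>. \<Sum>s. ?f s \<omega>)" by (rule integrable_suminf[OF int 1 2])
  have "expectation (\<lambda>\<omega>. \<Sum>s. ?f s \<omega>) = (\<Sum>s. expectation (?f s))"
    by (rule integral_suminf[OF int 1 2])
  also have "\<dots> \<le> (\<Sum>s. w (s + m) * \<sigma> (s + m))"
    by (rule suminf_le[OF le _ summ']) (use 2 in \<open>simp only: norm\<close>)
  finally show "expectation (\<lambda>\<omega>. \<Sum>s. ?f s \<omega>) \<le> (\<Sum>s. w (s + m) * \<sigma> (s + m))" .
qed

text \<open>The linear span of cosines of affine forms in the first \<open>m\<close> coordinates.
  The phase \<open>a\<close> supplies sines and constants and the amplitude \<open>r\<close>
  supplies scalar multiples, so closure under addition is enough.\<close>

inductive_set trig_sums :: "nat \<Rightarrow> ((nat \<Rightarrow> real) \<Rightarrow> real) set" for m where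
  cos: "(\<lambda>x. r * cos (a + (\<Sum>i<m. c i * x i))) \<in> trig_sums m"
| add: "f \<in> trig_sums m \<Longrightarrow> g \<in> trig_sums m \<Longrightarrow> (\<lambda>x. f x + g x) \<in> trig_sums m"

text \<open>By the product-to-sum formula for cosines the span is an algebra, as Stone-Weierstrass
  demands.\<close>

lemma trig_sums_mult:
  assumes "f \<in> trig_sums m" "g \<in> trig_sums m"
  shows "(\<lambda>x. f x * g x) \<in> trig_sums m"
  using assms
proof (induction f)
  case (cos r a c)
  from cos show ?case
  proof (induction g)
    case (cos r' a' c')
    have "(r * cos (a + (\<Sum>i<m. c i * x i))) * (r' * cos (a' + (\<Sum>i<m. c' i * x i))) =
      r * r' / 2 * cos ((a - a') + (\<Sum>i<m. (c i - c' i) * x i)) +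
      r * r' / 2 * cos ((a + a') + (\<Sum>i<m. (c i + c' i) * x i))" for x
    proof -
      have "(a - a') + (\<Sum>i<m. (c i - c' i) * x i) = (a + (\<Sum>i<m. c i * x i)) - (a' + (\<Sum>i<m. c' i * x i))"
        "(a + a') + (\<Sum>i<m. (c i + c' i) * x i) = (a + (\<Sum>i<m. c i * x i)) + (a' + (\<Sum>i<m. c' i * x i))"
        by (simp_all add: algebra_simps sum.distrib sum_subtractf)
      then show ?thesis by (simp only: cos_add cos_diff) (simp add: algebra_simps)
    qed
    then have eq: "(\<lambda>x. (r * cos (a + (\<Sum>i<m. c i * x i))) * (r' * cos (a' + (\<Sum>i<m. c' i * x i)))) =
      (\<lambda>x. r * r' / 2 * cos ((a - a') + (\<Sum>i<m. (c i - c' i) * x i)) +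
      r * r' / 2 * cos ((a + a') + (\<Sum>i<m. (c i + c' i) * x i)))"
      by (rule ext)
    show ?case unfolding eq by (intro trig_sums.add trig_sums.cos)
  next
    case (add f g)
    then show ?case unfolding distrib_left by (intro trig_sums.add)
  qed
next
  case (add f1 f2)
  then show ?case unfolding distrib_right by (intro trig_sums.add)
qed

lemma trig_sums_const: "(\<lambda>_. c) \<in> trig_sums m"
  using trig_sums.cos[of c 0 "\<lambda>_. 0" m] by simp

text \<open>Evaluating at \<open>sin (x i / C)\<close> turns polynomials on the cube into trigonometric sums
  that approximate uniformly in the unbounded variable \<open>x\<close>.\<close>

lemma trig_sums_approx:
  assumes F: "continuous_on UNIV (\<lambda>x. F (trunc m x) :: real)" and e: "e > 0"
  obtains p where "p \<in> trig_sums m" "\<And>x. \<bar>F (trunc m (\<lambda>i. C * sin (x i / C))) - p x\<bar> < e"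
proof -
  define sn where "sn = (\<lambda>x :: nat \<Rightarrow> real. trunc m (\<lambda>i. sin (x i / C)))"
  \<comment> \<open>Pinning the coordinates from \<open>m\<close> on to 0 lets the first
    \<open>m\<close> coordinates separate the points of the cube.\<close>
  define S where "S = Pi UNIV (\<lambda>i. if i < m then {-1..1} else {0::real})"
  \<comment> \<open>The algebra consists of functions of a point \<open>y\<close> of the cube,
    selected by what they become under the substitution \<open>y = sn x\<close>.\<close>
  define R where "R = {r. continuous_on UNIV r \<and> (\<lambda>x. r (sn x)) \<in> trig_sums m}"
  have "compactin (product_topology (\<lambda>_. euclidean) UNIV) (PiE UNIV (\<lambda>i. if i < m then {-1..1} else {0::real}))"
    by (subst compactin_PiE) auto
  then have S: "compact S" by (simp add: euclidean_product_topology S_def PiE_UNIV_domain)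
  interpret function_ring_on R S
  proof
    show "compact S" by (rule S)
    show "continuous_on S f" if "f \<in> R" for f
      using that continuous_on_subset[OF _ subset_UNIV[of S], of f] by (simp add: R_def)
    show "(\<lambda>x. f x + g x) \<in> R" "(\<lambda>x. f x * g x) \<in> R" if "f \<in> R" "g \<in> R" for f g
      using that by (simp_all add: R_def continuous_on_add continuous_on_mult trig_sums.add trig_sums_mult)
    show "(\<lambda>_. c) \<in> R" for c by (simp add: R_def trig_sums_const)
    show "\<exists>f\<in>R. f x \<noteq> f y" if xy: "x \<in> S" "y \<in> S" "x \<noteq> y" for x y
    proof -
      obtain i where i: "x i \<noteq> y i" using xy(3) by blast
      have "x i = 0 \<and> y i = 0" if "\<not> i < m"
        using Pi_mem[OF xy(1)[unfolded S_def], of i] Pi_mem[OF xy(2)[unfolded S_def], of i] that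
        by simp
      with i have im: "i < m" by metis
      \<comment> \<open>\<open>sin t = cos (t - pi / 2)\<close>, so the sine coordinates are
        generators.\<close>
      have "sn x i = 1 * cos (- (pi / 2) + (\<Sum>j<m. (if j = i then 1 / C else 0) * x j))" for x
      proof -
        have "(\<Sum>j<m. (if j = i then 1 / C else 0) * x j) = (\<Sum>j<m. if j = i then x j / C else 0)"
          by (intro sum.cong) auto
        also have "\<dots> = x i / C" using im by simp
        finally show ?thesis using im by (simp add: sn_def trunc_def cos_diff)
      qed
      then have eq: "(\<lambda>x. sn x i) =
          (\<lambda>x. 1 * cos (- (pi / 2) + (\<Sum>j<m. (if j = i then 1 / C else 0) * x j)))" by (rule ext)
      have "(\<lambda>x. sn x i) \<in> trig_sums m" unfolding eq by (rule trig_sums.cos)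
      then have "(\<lambda>x. x i) \<in> R" by (simp add: R_def)
      with i show ?thesis by (intro bexI[of _ "\<lambda>x. x i"])
    qed
  qed
  have "continuous_on UNIV ((\<lambda>x. F (trunc m x)) \<circ> (\<lambda>y i. C * y i))"
    by (intro continuous_on_compose continuous_on_subset[OF F subset_UNIV]
        continuous_on_coordinatewise_then_product continuous_on_mult_left
        continuous_on_product_coordinates)
  then have "continuous_on S (\<lambda>y. F (trunc m (\<lambda>i. C * y i)))"
    unfolding comp_def by (rule continuous_on_subset) simp
  from Stone_Weierstrass_basic[OF this e] obtain g where g: "g \<in> R"
    "\<And>y. y \<in> S \<Longrightarrow> \<bar>F (trunc m (\<lambda>i. C * y i)) - g y\<bar> < e" by blast
  show ?thesis
  proof
    show "(\<lambda>x. g (sn x)) \<in> trig_sums m" using g by (simp add: R_def)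
    fix x
    have "sn x \<in> S" by (auto simp: sn_def S_def trunc_def)
    moreover have "trunc m (\<lambda>i. C * sn x i) = trunc m (\<lambda>i. C * sin (x i / C))"
      by (auto simp: trunc_def sn_def)
    ultimately show "\<bar>F (trunc m (\<lambda>i. C * sin (x i / C))) - g (sn x)\<bar> < e"
      using g(2)[of "sn x"] by simp
  qed
qed

text \<open>Second-order Taylor bound for the sine. The error is kept quadratic because only second
  moments of the coordinates are controlled; its mean then vanishes as \<open>C\<close>
  grows.\<close>

lemma abs_minus_scaled_sin_le:
  fixes x C :: real
  assumes "C > 0"
  shows "\<bar>x - C * sin (x / C)\<bar> \<le> x\<^sup>2 / C"
proof -
  have "\<bar>sin (x / C) - x / C\<bar> \<le> (x / C)\<^sup>2 / 2"
    using Maclaurin_sin_bound[of "x / C" 2] by (simp add: numeral_2_eq_2 sin_coeff_def)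
  then have "C * \<bar>sin (x / C) - x / C\<bar> \<le> C * ((x / C)\<^sup>2 / 2)"
    using assms by (intro mult_left_mono) auto
  also have "\<dots> \<le> x\<^sup>2 / C" using assms by (simp add: power2_eq_square field_simps)
  also have "C * \<bar>sin (x / C) - x / C\<bar> = \<bar>C * (sin (x / C) - x / C)\<bar>"
    using assms by (simp add: abs_mult)
  also have "C * (sin (x / C) - x / C) = C * sin (x / C) - x"
    using assms by (simp add: right_diff_distrib)
  finally show ?thesis by (simp add: abs_minus_commute)
qed

lemma tendsto_if_uniformly_approximable:
  fixes a :: "nat \<Rightarrow> real"
  assumes "\<And>e. e > 0 \<Longrightarrow> \<exists>a' l'. a' \<longlonglongrightarrow> l' \<and> (\<forall>n. \<bar>a n - a' n\<bar> \<le> e) \<and> \<bar>l - l'\<bar> \<le> e"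
  shows "a \<longlonglongrightarrow> l"
proof (rule tendstoI)
  fix e :: real assume "e > 0"
  with assms[of "e / 3"] obtain a' l' where a': "a' \<longlonglongrightarrow> l'" and
    b: "\<And>n. \<bar>a n - a' n\<bar> \<le> e / 3" "\<bar>l - l'\<bar> \<le> e / 3" by auto
  from tendstoD[OF a', of "e / 3"] \<open>e > 0\<close> have "\<forall>\<^sub>F n in sequentially. dist (a' n) l' < e / 3" by simp
  then show "\<forall>\<^sub>F n in sequentially. dist (a n) l < e"
  proof eventually_elim
    case (elim n)
    then show ?case using b(1)[of n] b(2) unfolding dist_real_def by linarith
  qed
qed

text \<open>Three errors, in the order of the bound: cutting off the coordinates from
  \<open>m\<close> on, replacing \<open>x\<close> by \<open>C * sin (x / C)\<close> in the others,
  and the uniform approximation by \<open>p\<close>. Being stated for one random sequence, it serves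
  for each \<open>V N\<close> and for the limit alike.\<close>

lemma (in prob_space) expectation_diff_trig_le:
  assumes h: "lipschitz_l1 w L h" and w: "\<And>s. w s \<ge> 0"
    and X[measurable]: "\<And>s. (\<lambda>\<omega>. X \<omega> s) \<in> borel_measurable M"
    and sq: "\<And>s. integrable M (\<lambda>\<omega>. (X \<omega> s)\<^sup>2)"
    and var: "\<And>s. expectation (\<lambda>\<omega>. (X \<omega> s)\<^sup>2) \<le> (\<sigma> s)\<^sup>2"
    and \<sigma>: "\<And>s. \<sigma> s \<ge> 0" and summ: "summable (\<lambda>s. w s * \<sigma> s)"
    and l1: "\<And>\<omega>. \<omega> \<in> space M \<Longrightarrow> X \<omega> \<in> weighted_l1 w"
    and hb: "\<And>\<omega>. \<omega> \<in> space M \<Longrightarrow> \<bar>h (X \<omega>)\<bar> \<le> B"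
    and C: "C > 0" and p: "\<And>x. \<bar>h (trunc m (\<lambda>i. C * sin (x i / C))) - p x\<bar> < e"
    and pm: "(\<lambda>\<omega>. p (X \<omega>)) \<in> borel_measurable M" and pb: "\<And>x. \<bar>p x\<bar> \<le> B'"
  shows "\<bar>expectation (\<lambda>\<omega>. h (X \<omega>)) - expectation (\<lambda>\<omega>. p (X \<omega>))\<bar>
    \<le> L * (\<Sum>s. w (s + m) * \<sigma> (s + m)) + L * (\<Sum>s<m. w s * (\<sigma> s)\<^sup>2) / C + e"
proof -
  note tail = expectation_tail_le[OF X sq var \<sigma> w summ, OF AE_I2, OF l1]
  let ?T = "\<lambda>\<omega>. \<Sum>s. w (s + m) * \<bar>X \<omega> (s + m)\<bar>"
  let ?Q = "\<lambda>\<omega>. \<Sum>s<m. w s * (X \<omega> s)\<^sup>2"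
  have L: "L \<ge> 0" using h by (simp add: lipschitz_l1_def)
  have ptw: "\<bar>h (X \<omega>) - p (X \<omega>)\<bar> \<le> L * ?T \<omega> + L * ?Q \<omega> / C + e" if \<omega>: "\<omega> \<in> space M" for \<omega>
  proof -
    have "\<bar>h (trunc m (X \<omega>)) - h (trunc m (\<lambda>i. C * sin (X \<omega> i / C)))\<bar>
        \<le> L * (\<Sum>s<m. w s * \<bar>X \<omega> s - C * sin (X \<omega> s / C)\<bar>)"
      by (rule lipschitz_l1_trunc[OF h])
    also have "\<dots> \<le> L * (\<Sum>s<m. w s * ((X \<omega> s)\<^sup>2 / C))"
      using w L abs_minus_scaled_sin_le[OF C] by (intro mult_left_mono sum_mono) auto
    also have "\<dots> = L * ?Q \<omega> / C" by (simp add: sum_divide_distrib sum_distrib_left)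
    finally show ?thesis
      using lipschitz_l1_trunc_tail[OF h l1[OF \<omega>], of m] p[of "X \<omega>"] by linarith
  qed
  have ih: "integrable M (\<lambda>\<omega>. h (X \<omega>))"
    by (rule integrable_const_bound[of _ B, OF AE_I2 measurable_lipschitz_l1(2)[OF h X l1]])
      (use hb in auto)
  have ip: "integrable M (\<lambda>\<omega>. p (X \<omega>))"
    by (rule integrable_const_bound[of _ B', OF AE_I2 pm]) (use pb in auto)
  have iT: "integrable M ?T" by (rule tail(1))
  have iQ: "integrable M ?Q" using sq by auto
  have "\<bar>expectation (\<lambda>\<omega>. h (X \<omega>)) - expectation (\<lambda>\<omega>. p (X \<omega>))\<bar> =
      \<bar>expectation (\<lambda>\<omega>. h (X \<omega>) - p (X \<omega>))\<bar>"
    using ih ip by simp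
  also have "\<dots> \<le> expectation (\<lambda>\<omega>. \<bar>h (X \<omega>) - p (X \<omega>)\<bar>)" by (rule integral_abs_bound)
  also have "\<dots> \<le> expectation (\<lambda>\<omega>. L * ?T \<omega> + L * ?Q \<omega> / C + e)"
    by (rule integral_mono) (use ih ip iT iQ ptw in auto)
  also have "\<dots> = L * expectation ?T + L * expectation ?Q / C + e"
    using iT iQ by (simp add: prob_space)
  also have "\<dots> \<le> L * (\<Sum>s. w (s + m) * \<sigma> (s + m)) + L * (\<Sum>s<m. w s * (\<sigma> s)\<^sup>2) / C + e"
  proof -
    have "expectation ?Q = (\<Sum>s<m. w s * expectation (\<lambda>\<omega>. (X \<omega> s)\<^sup>2))"
      using sq by (simp add: Bochner_Integration.integral_sum)
    also have "\<dots> \<le> (\<Sum>s<m. w s * (\<sigma> s)\<^sup>2)"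
      using w var by (intro sum_mono mult_left_mono) auto
    finally show ?thesis using L C tail(2)[of m]
      by (intro add_mono mult_left_mono divide_right_mono) auto
  qed
  finally show ?thesis .
qed

lemma trig_sums_bounded:
  assumes "p \<in> trig_sums m"
  shows "\<exists>B. \<forall>x. \<bar>p x\<bar> \<le> B"
  using assms
proof induction
  case (cos r a c)
  have "\<bar>r * cos (a + (\<Sum>i<m. c i * x i))\<bar> \<le> \<bar>r\<bar>" for x
    by (simp add: abs_mult mult_left_le)
  then show ?case by blast
next
  case (add f g)
  then obtain B1 B2 where "\<bar>f x\<bar> \<le> B1" "\<bar>g x\<bar> \<le> B2" for x by blast
  then have "\<bar>f x + g x\<bar> \<le> B1 + B2" for x
    by (rule order_trans[OF abs_triangle_ineq add_mono])
  then show ?case by blast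
qed

lemma trig_sums_measurable:
  assumes "p \<in> trig_sums m" and [measurable]: "\<And>s. (\<lambda>\<omega>. X \<omega> s) \<in> borel_measurable M"
  shows "(\<lambda>\<omega>. p (X \<omega>)) \<in> borel_measurable M"
  using assms(1) by induction auto

text \<open>Truncation to finitely many coordinates and the substitution \<open>C * sin (x / C)\<close> both cost
  little in mean, uniformly along the sequence, because second moments are dominated by
  \<open>\<sigma>\<^sup>2\<close>. What remains is a trigonometric sum, covered by the hypothesis on characters.\<close>

lemma weighted_l1_convergence:
  assumes P: "prob_space P" and P': "prob_space P'"
    and w: "\<And>s. w s \<ge> 0" and \<sigma>: "\<And>s. \<sigma> s \<ge> 0" and summ: "summable (\<lambda>s. w s * \<sigma> s)"
    and mV: "\<And>N s. (\<lambda>\<omega>. V N \<omega> s) \<in> borel_measurable P"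
    and mZ: "\<And>s. (\<lambda>\<omega>. Z \<omega> s) \<in> borel_measurable P'"
    and lV: "\<And>N \<omega>. \<omega> \<in> space P \<Longrightarrow> V N \<omega> \<in> weighted_l1 w"
    and lZ: "\<And>\<omega>. \<omega> \<in> space P' \<Longrightarrow> Z \<omega> \<in> weighted_l1 w"
    and sV: "\<And>N s. integrable P (\<lambda>\<omega>. (V N \<omega> s)\<^sup>2)" "\<And>N s. (LINT \<omega>|P. (V N \<omega> s)\<^sup>2) \<le> (\<sigma> s)\<^sup>2"
    and sZ: "\<And>s. integrable P' (\<lambda>\<omega>. (Z \<omega> s)\<^sup>2)" "\<And>s. (LINT \<omega>|P'. (Z \<omega> s)\<^sup>2) \<le> (\<sigma> s)\<^sup>2"
    and chars: "\<And>m a c. (\<lambda>N. LINT \<omega>|P. cos (a + (\<Sum>i<m. c i * V N \<omega> i)))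
                   \<longlonglongrightarrow> (LINT \<omega>|P'. cos (a + (\<Sum>i<m. c i * Z \<omega> i)))"
    and h: "lipschitz_l1 w L h" and hb: "\<And>x. x \<in> weighted_l1 w \<Longrightarrow> \<bar>h x\<bar> \<le> B"
  shows "(\<lambda>N. LINT \<omega>|P. h (V N \<omega>)) \<longlonglongrightarrow> (LINT \<omega>|P'. h (Z \<omega>))"
proof (rule tendsto_if_uniformly_approximable)
  interpret P: prob_space P by fact
  interpret P': prob_space P' by fact
  fix e :: real assume e: "e > 0"
  have L: "L \<ge> 0" using h by (simp add: lipschitz_l1_def)
  have "(\<lambda>m. L * (\<Sum>s. w (s + m) * \<sigma> (s + m))) \<longlonglongrightarrow> L * 0"
    by (intro tendsto_intros suminf_exist_split2 summ)
  then have "\<forall>\<^sub>F m in sequentially. L * (\<Sum>s. w (s + m) * \<sigma> (s + m)) < e / 3"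
    by (rule order_tendstoD) (use e in simp)
  then obtain m where m: "L * (\<Sum>s. w (s + m) * \<sigma> (s + m)) < e / 3"
    using eventually_happens by force
  define K where "K = L * (\<Sum>s<m. w s * (\<sigma> s)\<^sup>2)"
  have K: "K \<ge> 0" unfolding K_def using L w by (intro mult_nonneg_nonneg sum_nonneg) auto
  \<comment> \<open>The order of choice matters: \<open>K\<close> depends on \<open>m\<close>,
    \<open>C\<close> on \<open>K\<close>, and \<open>p\<close> below on \<open>m\<close> and
    \<open>C\<close>. The summand 1 keeps \<open>C\<close> positive when
    \<open>K = 0\<close>.\<close>
  define C where "C = 3 * (K + 1) / e"
  have C: "C > 0" using e K by (simp add: C_def)
  have KC: "K / C \<le> e / 3" using e K by (simp add: C_def field_simps)
  obtain p where p: "p \<in> trig_sums m"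
    "\<And>x. \<bar>h (trunc m (\<lambda>i. C * sin (x i / C))) - p x\<bar> < e / 3"
    using trig_sums_approx[OF continuous_on_lipschitz_l1_trunc[OF h], where e="e / 3" and m=m and C=C] e by auto
  obtain B' where B': "\<And>x. \<bar>p x\<bar> \<le> B'" using trig_sums_bounded[OF p(1)] by auto
  have "(\<lambda>N. LINT \<omega>|P. p (V N \<omega>)) \<longlonglongrightarrow> (LINT \<omega>|P'. p (Z \<omega>))"
    using p(1)
  proof induction
    case (cos r a c)
    show ?case using tendsto_mult_left[OF chars[where a=a and m=m and c=c], of r] by simp
  next
    case (add f g)
    obtain B1 B2 where B: "\<And>x. \<bar>f x\<bar> \<le> B1" "\<And>x. \<bar>g x\<bar> \<le> B2"
      using trig_sums_bounded[OF add.hyps(1)] trig_sums_bounded[OF add.hyps(2)] by blast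
    have "integrable P (\<lambda>\<omega>. f (V N \<omega>))" "integrable P (\<lambda>\<omega>. g (V N \<omega>))" for N
      using B
      by (auto intro!: P.integrable_const_bound[of _ B1, OF _ trig_sums_measurable[OF add.hyps(1) mV]]
          P.integrable_const_bound[of _ B2, OF _ trig_sums_measurable[OF add.hyps(2) mV]])
    moreover have "integrable P' (\<lambda>\<omega>. f (Z \<omega>))" "integrable P' (\<lambda>\<omega>. g (Z \<omega>))"
      using B
      by (auto intro!: P'.integrable_const_bound[of _ B1, OF _ trig_sums_measurable[OF add.hyps(1) mZ]]
          P'.integrable_const_bound[of _ B2, OF _ trig_sums_measurable[OF add.hyps(2) mZ]])
    ultimately show ?case using tendsto_add[OF add.IH] by simp
  qed
  moreover have "\<bar>(LINT \<omega>|P. h (V N \<omega>)) - (LINT \<omega>|P. p (V N \<omega>))\<bar> \<le> e" for N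
  proof -
    have "\<bar>(LINT \<omega>|P. h (V N \<omega>)) - (LINT \<omega>|P. p (V N \<omega>))\<bar>
      \<le> L * (\<Sum>s. w (s + m) * \<sigma> (s + m)) + L * (\<Sum>s<m. w s * (\<sigma> s)\<^sup>2) / C + e / 3"
      by (rule P.expectation_diff_trig_le[where h=h and B=B and B'=B', OF h w mV sV \<sigma> summ lV _ C p(2)
            trig_sums_measurable[OF p(1) mV] B']) (use hb lV in auto)
    then show ?thesis using m KC unfolding K_def by linarith
  qed
  moreover have "\<bar>(LINT \<omega>|P'. h (Z \<omega>)) - (LINT \<omega>|P'. p (Z \<omega>))\<bar> \<le> e"
  proof -
    have "\<bar>(LINT \<omega>|P'. h (Z \<omega>)) - (LINT \<omega>|P'. p (Z \<omega>))\<bar>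
      \<le> L * (\<Sum>s. w (s + m) * \<sigma> (s + m)) + L * (\<Sum>s<m. w s * (\<sigma> s)\<^sup>2) / C + e / 3"
      by (rule P'.expectation_diff_trig_le[where h=h and B=B and B'=B', OF h w mZ sZ \<sigma> summ lZ _ C p(2)
            trig_sums_measurable[OF p(1) mZ] B']) (use hb lZ in auto)
    then show ?thesis using m KC unfolding K_def by linarith
  qed
  ultimately show "\<exists>a' l'. a' \<longlonglongrightarrow> l' \<and> (\<forall>n. \<bar>(LINT \<omega>|P. h (V n \<omega>)) - a' n\<bar> \<le> e) \<and>
      \<bar>(LINT \<omega>|P'. h (Z \<omega>)) - l'\<bar> \<le> e" by blast
qed

subsection \<open>The operator S\<close>

text \<open>Apart from \<open>\<bar>x (n + j)\<bar>\<close> and the power of \<open>q\<close>, the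
  left side is the term \<open>k = n\<close> in the expansion of
  \<open>(b + (1 - q)) ^ (n + j)\<close>, whose terms are all nonnegative. The ratio
  \<open>(b + 1 - q) / q\<close> originates here.\<close>

lemma S_term_le:
  fixes q b :: real
  assumes q: "0 < q" "q < 1" and b: "b \<ge> 0"
  shows "b ^ n * \<bar>S_term q x n j\<bar> \<le> ((b + 1 - q) / q) ^ (n + j) * \<bar>x (n + j)\<bar>"
proof -
  have "real ((n + j) choose n) * b ^ n * (1 - q) ^ (n + j - n)
      \<le> (\<Sum>k\<le>n + j. real ((n + j) choose k) * b ^ k * (1 - q) ^ (n + j - k))"
    by (rule member_le_sum) (use q b in auto)
  also have "\<dots> = (b + (1 - q)) ^ (n + j)" by (simp add: binomial_ring)
  finally have le: "real ((n + j) choose n) * b ^ n * (1 - q) ^ j \<le> (b + 1 - q) ^ (n + j)"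
    by (simp add: add_diff_eq)
  have "b ^ n * \<bar>S_term q x n j\<bar> =
      (real ((n + j) choose n) * b ^ n * (1 - q) ^ j) * (\<bar>x (n + j)\<bar> / q ^ (n + j))"
    using q by (simp add: S_term_def abs_mult power_abs)
  also have "\<dots> \<le> (b + 1 - q) ^ (n + j) * (\<bar>x (n + j)\<bar> / q ^ (n + j))"
    using le q by (intro mult_right_mono) auto
  also have "\<dots> = ((b + 1 - q) / q) ^ (n + j) * \<bar>x (n + j)\<bar>" by (simp add: power_divide)
  finally show ?thesis .
qed

text \<open>Summing the termwise bound over \<open>j\<close> yields the part of the weighted series
  from index \<open>n\<close> on. Enlarged to the whole series it no longer depends on
  \<open>n\<close>, which is what a supremum norm of the image asks for.\<close>

lemma
  fixes q b :: real
  assumes q: "0 < q" "q < 1" and b: "b > 0"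
    and x: "x \<in> weighted_l1 (\<lambda>s. ((b + 1 - q) / q) ^ s)"
  shows summable_S_term: "summable (S_term q x n)"
    and S_op_le: "b ^ n * \<bar>S_op q x n\<bar> \<le> (\<Sum>s. ((b + 1 - q) / q) ^ s * \<bar>x s\<bar>)"
proof -
  let ?z = "(b + 1 - q) / q"
  have z: "?z > 0" using q b by simp
  have sx: "summable (\<lambda>s. ?z ^ s * \<bar>x s\<bar>)" using x by (simp add: weighted_l1_def)
  have sx': "summable (\<lambda>j. ?z ^ (n + j) * \<bar>x (n + j)\<bar>)"
    using summable_ignore_initial_segment[OF sx, of n] by (simp add: add.commute)
  have le: "b ^ n * \<bar>S_term q x n j\<bar> \<le> ?z ^ (n + j) * \<bar>x (n + j)\<bar>" for j
    by (rule S_term_le) (use q b in auto)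
  have "summable (\<lambda>j. b ^ n * \<bar>S_term q x n j\<bar>)"
    by (rule summable_comparison_test'[OF sx', of 0]) (use le b in auto)
  then have abs: "summable (\<lambda>j. \<bar>S_term q x n j\<bar>)"
    using b by (subst (asm) summable_cmult_iff) auto
  then show "summable (S_term q x n)" by (rule summable_rabs_cancel)
  have "b ^ n * \<bar>S_op q x n\<bar> \<le> b ^ n * (\<Sum>j. \<bar>S_term q x n j\<bar>)"
    unfolding S_op_def using b by (intro mult_left_mono summable_rabs abs) auto
  also have "\<dots> = (\<Sum>j. b ^ n * \<bar>S_term q x n j\<bar>)" by (rule suminf_mult[OF abs, symmetric])
  also have "\<dots> \<le> (\<Sum>j. ?z ^ (n + j) * \<bar>x (n + j)\<bar>)"
    by (rule suminf_le[OF le summable_mult[OF abs] sx'])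
  also have "\<dots> \<le> (\<Sum>s. ?z ^ s * \<bar>x s\<bar>)"
    using suminf_split_initial_segment[OF sx, of n] z
    by (simp add: add.commute sum_nonneg)
  finally show "b ^ n * \<bar>S_op q x n\<bar> \<le> (\<Sum>s. ?z ^ s * \<bar>x s\<bar>)" .
qed

lemma weighted_l1_diff:
  assumes w: "\<And>s. w s \<ge> 0" and x: "x \<in> weighted_l1 w" and y: "y \<in> weighted_l1 w"
  shows "(\<lambda>s. x s - y s) \<in> weighted_l1 w"
proof -
  have "summable (\<lambda>s. w s * \<bar>x s\<bar> + w s * \<bar>y s\<bar>)"
    using x y by (intro summable_add) (auto simp: weighted_l1_def)
  then show ?thesis unfolding weighted_l1_def mem_Collect_eq
  proof (rule summable_comparison_test'[of _ 0])
    fix s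
    have "w s * \<bar>x s - y s\<bar> \<le> w s * (\<bar>x s\<bar> + \<bar>y s\<bar>)" using w by (intro mult_left_mono) auto
    then show "norm (w s * \<bar>x s - y s\<bar>) \<le> w s * \<bar>x s\<bar> + w s * \<bar>y s\<bar>"
      using w by (simp add: distrib_left)
  qed
qed

lemma S_op_diff:
  assumes "summable (S_term q x n)" "summable (S_term q y n)"
  shows "S_op q (\<lambda>s. x s - y s) n = S_op q x n - S_op q y n"
proof -
  have "S_term q (\<lambda>s. x s - y s) n = (\<lambda>j. S_term q x n j - S_term q y n j)"
    by (rule ext) (simp add: S_term_def right_diff_distrib diff_divide_distrib)
  then show ?thesis unfolding S_op_def by (simp add: suminf_diff[OF assms])
qed

lemma S_op_scale:
  assumes "summable (S_term q x n)"
  shows "S_op q (\<lambda>s. c * x s) n = c * S_op q x n"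
proof -
  have "S_term q (\<lambda>s. c * x s) n = (\<lambda>j. c * S_term q x n j)"
    by (rule ext) (simp add: S_term_def)
  then show ?thesis unfolding S_op_def by (simp add: suminf_mult[OF assms])
qed

text \<open>The weight is built from the larger parameter, and \<open>a ^ n \<le> b ^ n\<close>
  passes the bound to the smaller one; in the theorem these are \<open>b\<close> and
  \<open>b'\<close>. Linearity turns the distance of two images into the norm of the image of the
  difference.\<close>

lemma
  fixes q a b :: real
  assumes q: "0 < q" "q < 1" and ab: "0 < a" "a \<le> b"
    and x: "x \<in> weighted_l1 (\<lambda>s. ((b + 1 - q) / q) ^ s)"
  shows S_op_in_linf: "(S_op q x)(0 := 0) \<in> linf a"
    and linf_dist_S_op_le: "y \<in> weighted_l1 (\<lambda>s. ((b + 1 - q) / q) ^ s) \<Longrightarrow>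
      linf_dist a ((S_op q x)(0 := 0)) ((S_op q y)(0 := 0)) \<le>
        (\<Sum>s. ((b + 1 - q) / q) ^ s * \<bar>x s - y s\<bar>)"
proof -
  let ?w = "\<lambda>s. ((b + 1 - q) / q) ^ s"
  have b: "b > 0" using ab by simp
  have w: "?w s \<ge> 0" for s using q b by simp
  have le: "a ^ n * \<bar>((S_op q x)(0 := 0)) n\<bar> \<le> (\<Sum>s. ?w s * \<bar>x s\<bar>)" if "x \<in> weighted_l1 ?w" for x n
  proof (cases "n = 0")
    case True
    then show ?thesis using that w by (auto simp: weighted_l1_def intro!: suminf_nonneg)
  next
    case False
    have "a ^ n * \<bar>S_op q x n\<bar> \<le> b ^ n * \<bar>S_op q x n\<bar>"
      using ab by (intro mult_right_mono power_mono) auto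
    also have "\<dots> \<le> (\<Sum>s. ?w s * \<bar>x s\<bar>)" by (rule S_op_le[OF q b that])
    finally show ?thesis using False by simp
  qed
  have mem: "(S_op q x)(0 := 0) \<in> linf a" if "x \<in> weighted_l1 ?w" for x
    unfolding linf_def mem_Collect_eq using le[OF that] by (rule bdd_aboveI2)
  show "(S_op q x)(0 := 0) \<in> linf a" by (rule mem[OF x])
  assume y: "y \<in> weighted_l1 ?w"
  have eq: "(\<lambda>n. ((S_op q x)(0 := 0)) n - ((S_op q y)(0 := 0)) n) = (S_op q (\<lambda>s. x s - y s))(0 := 0)"
    using S_op_diff[OF summable_S_term[OF q b x] summable_S_term[OF q b y]] by (simp add: fun_eq_iff)
  have "linf_dist a ((S_op q x)(0 := 0)) ((S_op q y)(0 := 0)) =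
      linf_norm a ((S_op q (\<lambda>s. x s - y s))(0 := 0))"
    using mem[OF x] mem[OF y] unfolding linf_dist_def eq by (simp only: simp_thms if_True)
  also have "\<dots> \<le> (\<Sum>s. ?w s * \<bar>x s - y s\<bar>)"
    unfolding linf_norm_def by (rule cSUP_least) (use le[OF weighted_l1_diff[OF w x y]] in auto)
  finally show "linf_dist a ((S_op q x)(0 := 0)) ((S_op q y)(0 := 0)) \<le> (\<Sum>s. ?w s * \<bar>x s - y s\<bar>)" .
qed

text \<open>The powers of \<open>q\<close> cancel, trinomial revision factors out
  \<open>v choose n\<close>, and the alternating sum of the binomial coefficients of
  \<open>v - n\<close> vanishes unless \<open>v = n\<close>. So \<open>S\<close> turns the binomial
  law with \<open>v\<close> trials into the point mass at \<open>v\<close>.\<close>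

lemma S_term_binomial_sums:
  fixes q c :: real
  assumes q: "0 < q" "q < 1"
  shows "S_term q (\<lambda>s. c * (real (v choose s) * q ^ s * (1 - q) ^ (v - s))) n sums (if v = n then c else 0)"
proof (cases "n \<le> v")
  case False
  then have "S_term q (\<lambda>s. c * (real (v choose s) * q ^ s * (1 - q) ^ (v - s))) n = (\<lambda>_. 0)"
    by (auto simp: S_term_def fun_eq_iff)
  then show ?thesis using False by auto
next
  case True
  let ?t = "S_term q (\<lambda>s. c * (real (v choose s) * q ^ s * (1 - q) ^ (v - s))) n"
  let ?K = "c * (1 - q) ^ (v - n) * real (v choose n)"
  have t: "?t j = ?K * ((- 1) ^ j * of_nat ((v - n) choose j))" if j: "j \<le> v - n" for j
  proof -
    have "real (v choose (n + j)) * real ((n + j) choose n) = real (v choose n) * real ((v - n) choose j)"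
      using choose_mult[of n "n + j" v] True j by (metis add_diff_cancel_left' le_add1 le_diff_conv2 add.commute of_nat_mult)
    moreover have "(1 - q) ^ (v - n) = (1 - q) ^ j * (1 - q) ^ (v - (n + j))"
    proof -
      have "v - n = j + (v - (n + j))" using j True by simp
      then show ?thesis by (metis power_add)
    qed
    ultimately have eq: "?K * ((- 1) ^ j * of_nat ((v - n) choose j)) =
        c * ((1 - q) ^ j * (1 - q) ^ (v - (n + j))) * (- 1) ^ j * (real (v choose (n + j)) * real ((n + j) choose n))"
      by (simp add: mult_ac)
    show ?thesis unfolding eq using q by (simp add: S_term_def mult_ac)
  qed
  have "?t sums (\<Sum>j\<le>v - n. ?t j)"
    by (rule sums_finite) (auto simp: S_term_def)
  also have "(\<Sum>j\<le>v - n. ?t j) = ?K * (\<Sum>j\<le>v - n. (- 1) ^ j * of_nat ((v - n) choose j))"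
    by (simp add: t sum_distrib_left)
  also have "\<dots> = (if v = n then c else 0)"
    using choose_alternating_sum[of "v - n", where ?'a = real] True by auto
  finally show ?thesis .
qed

text \<open>By linearity \<open>S\<close> inverts every finite mixture of binomial laws; the bound
  \<open>S_op_le\<close> carries this over to the limit, so no double series has to be rearranged.\<close>

lemma S_op_thinning:
  fixes f g :: "nat \<Rightarrow> real" and q b :: real
  assumes q: "0 < q" "q < 1" and b: "b > 0" and g: "\<And>v. g v \<ge> 0"
    and f: "\<And>s. (\<lambda>v. g v * (real (v choose s) * q ^ s * (1 - q) ^ (v - s))) sums f s"
    and fl: "f \<in> weighted_l1 (\<lambda>s. ((b + 1 - q) / q) ^ s)"
  shows "S_op q f n = g n"
proof -
  let ?z = "(b + 1 - q) / q"
  let ?J = "\<lambda>v s. g v * (real (v choose s) * q ^ s * (1 - q) ^ (v - s))"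
  have z: "?z > 0" using q b by simp
  have J: "?J v s \<ge> 0" for v s using q g by simp
  have part: "(\<Sum>v<K. ?J v s) \<le> f s" for K s
    using sum_le_suminf[OF sums_summable[OF f], of "{..<K}" s] J sums_unique[OF f[of s]] by simp
  have part0: "0 \<le> (\<Sum>v<K. ?J v s)" for K s by (rule sum_nonneg) (use J in simp)
  have f0: "f s \<ge> 0" for s using part[where K = 0 and s = s] by simp
  have sf: "summable (\<lambda>s. ?z ^ s * f s)" using fl f0 by (simp add: weighted_l1_def)
  have fK: "(\<lambda>s. \<Sum>v<K. ?J v s) \<in> weighted_l1 (\<lambda>s. ?z ^ s)" for K
    unfolding weighted_l1_def mem_Collect_eq
    by (rule summable_comparison_test'[OF sf, of 0]) (use part part0 z in \<open>auto intro!: mult_left_mono\<close>)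
  \<comment> \<open>Once \<open>K > n\<close> the partial mixture contains the component
    \<open>v = n\<close>, the only one that contributes to \<open>S\<close> at index
    \<open>n\<close>.\<close>
  have S_fK: "S_op q (\<lambda>s. \<Sum>v<K. ?J v s) n = g n" if "K > n" for K
  proof -
    have "(\<lambda>j. \<Sum>v<K. S_term q (?J v) n j) sums (\<Sum>v<K. if v = n then g v else 0)"
      by (intro sums_sum S_term_binomial_sums q)
    also have "(\<lambda>j. \<Sum>v<K. S_term q (?J v) n j) = S_term q (\<lambda>s. \<Sum>v<K. ?J v s) n"
      by (simp add: S_term_def sum_distrib_left fun_eq_iff)
    finally show ?thesis using that unfolding S_op_def by (simp add: sums_iff)
  qed
  \<comment> \<open>The partial mixtures increase to \<open>f\<close>, so the error is dominated by
    \<open>f\<close> itself, and Tannery's theorem gives convergence in the weighted norm.\<close>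
  have "(\<lambda>K. \<Sum>s. ?z ^ s * \<bar>f s - (\<Sum>v<K. ?J v s)\<bar>) \<longlonglongrightarrow> (\<Sum>s. 0)"
  proof (rule tannerys_theorem[where M="\<lambda>s. ?z ^ s * f s", THEN conjunct2, THEN conjunct2])
    show "(\<lambda>K. ?z ^ s * \<bar>f s - (\<Sum>v<K. ?J v s)\<bar>) \<longlonglongrightarrow> 0" for s
    proof -
      have "(\<lambda>K. ?z ^ s * \<bar>f s - (\<Sum>v<K. ?J v s)\<bar>) \<longlonglongrightarrow> ?z ^ s * \<bar>f s - f s\<bar>"
        using f[of s] unfolding sums_def by (intro tendsto_intros)
      then show ?thesis by simp
    qed
    show "\<forall>\<^sub>F (s, K) in sequentially \<times>\<^sub>F sequentially. norm (?z ^ s * \<bar>f s - (\<Sum>v<K. ?J v s)\<bar>) \<le> ?z ^ s * f s"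
      by (rule always_eventually) (use part part0 z in \<open>auto simp: abs_mult intro!: mult_left_mono\<close>)
  qed (use sf in auto)
  then have lim: "(\<lambda>K. \<Sum>s. ?z ^ s * \<bar>f s - (\<Sum>v<K. ?J v s)\<bar>) \<longlonglongrightarrow> 0" by simp
  \<comment> \<open>The left side is free of \<open>K\<close>, while the right side tends to
    0.\<close>
  have "b ^ n * \<bar>S_op q f n - g n\<bar> \<le> (\<Sum>s. ?z ^ s * \<bar>f s - (\<Sum>v<K. ?J v s)\<bar>)" if K: "K > n" for K
    using S_op_le[OF q b weighted_l1_diff[OF _ fl fK[of K]], of n] z
      S_op_diff[OF summable_S_term[OF q b fl] summable_S_term[OF q b fK[of K]], of n] S_fK[OF K]
    by simp
  then have "b ^ n * \<bar>S_op q f n - g n\<bar> \<le> 0"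
    by (intro tendsto_lowerbound[OF lim]) (auto intro: eventually_mono[OF eventually_gt_at_top[of n]])
  then show ?thesis using zero_less_power[OF b, of n] by (auto simp: mult_le_0_iff)
qed

subsection \<open>Limit theorem for linear statistics\<close>

text \<open>The copies are numbered from 1, whereas the central limit theorem takes a family indexed
  by all of \<open>nat\<close>.\<close>

lemma (in prob_space) indep_vars_Suc:
  assumes "indep_vars (\<lambda>_. N) X {1..}"
  shows "indep_vars (\<lambda>_. N) (\<lambda>i. X (Suc i)) UNIV"
  unfolding indep_vars_def2 indep_sets_def
proof (intro conjI ballI allI impI)
  let ?F = "\<lambda>i. {X i -` A \<inter> space M |A. A \<in> sets N}"
  note ind = assms[unfolded indep_vars_def2 indep_sets_def]
  show "random_variable N (X (Suc i))" for i using ind by auto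
  show "?F (Suc i) \<subseteq> events" for i using ind by auto
  fix J :: "nat set" and A
  assume J: "J \<noteq> {}" "finite J" and A: "A \<in> Pi J (\<lambda>i. ?F (Suc i))"
  have "(\<lambda>k. A (k - 1)) \<in> Pi (Suc ` J) ?F" using A by (auto simp: Pi_iff)
  then have "prob (\<Inter>j\<in>Suc ` J. A (j - 1)) = (\<Prod>j\<in>Suc ` J. prob (A (j - 1)))"
    using ind J by (auto dest!: conjunct2 spec[of _ "Suc ` J"])
  then show "prob (\<Inter>j\<in>J. A j) = (\<Prod>j\<in>J. prob (A j))"
    by (simp add: prod.reindex)
qed

lemma
  assumes M: "prob_space M" and iid: "iid_copies M X M0 X0" and k: "k \<ge> 1"
  shows iid_copies_measurable: "X k \<in> measurable M (count_space UNIV)"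
    and iid_copies_expectation: "X0 \<in> measurable M0 (count_space UNIV) \<Longrightarrow>
      (LINT \<omega>|M. (\<phi> (X k \<omega>) :: real)) = (LINT \<omega>|M0. \<phi> (X0 \<omega>))"
proof -
  interpret prob_space M by fact
  show X: "X k \<in> measurable M (count_space UNIV)"
    using iid k unfolding iid_copies_def indep_vars_def2 by auto
  assume X0: "X0 \<in> measurable M0 (count_space UNIV)"
  have "(LINT \<omega>|M. \<phi> (X k \<omega>)) = integral\<^sup>L (distr M (count_space UNIV) (X k)) \<phi>"
    by (rule integral_distr[symmetric]) (use X in auto)
  also have "\<dots> = integral\<^sup>L (distr M0 (count_space UNIV) X0) \<phi>"
    using iid k by (simp add: iid_copies_def)
  also have "\<dots> = (LINT \<omega>|M0. \<phi> (X0 \<omega>))" by (rule integral_distr) (use X0 in auto)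
  finally show "(LINT \<omega>|M. \<phi> (X k \<omega>)) = (LINT \<omega>|M0. \<phi> (X0 \<omega>))" .
qed

lemma measurable_comp_count_space:
  "X \<in> measurable M (count_space UNIV) \<Longrightarrow> (\<lambda>\<omega>. (\<phi> (X \<omega>) :: real)) \<in> borel_measurable M"
  by (erule measurable_compose) simp

text \<open>Independence and zero mean remove the off-diagonal products; the second moment grows
  linearly in \<open>N\<close>, and division by \<open>sqrt N\<close> keeps it fixed.\<close>

lemma iid_copies_sum_square:
  fixes \<phi> :: "nat \<Rightarrow> real"
  assumes M: "prob_space M" and iid: "iid_copies M X M0 X0"
    and X0: "X0 \<in> measurable M0 (count_space UNIV)"
    and bd: "\<And>n. \<bar>\<phi> n\<bar> \<le> B" and mean: "(LINT \<omega>|M0. \<phi> (X0 \<omega>)) = 0"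
  shows "integrable M (\<lambda>\<omega>. (\<Sum>k=1..N. \<phi> (X k \<omega>))\<^sup>2)"
    and "(LINT \<omega>|M. (\<Sum>k=1..N. \<phi> (X k \<omega>))\<^sup>2) = real N * (LINT \<omega>|M0. (\<phi> (X0 \<omega>))\<^sup>2)"
proof -
  interpret prob_space M by fact
  let ?Y = "\<lambda>k \<omega>. \<phi> (X k \<omega>)"
  have mY: "?Y k \<in> borel_measurable M" if "k \<in> {1..N}" for k
    by (rule measurable_comp_count_space[OF iid_copies_measurable[OF M iid]]) (use that in simp)
  have int: "integrable M (?Y k)" if "k \<in> {1..N}" for k
    by (rule integrable_const_bound[of _ B, OF _ mY[OF that]]) (use bd in auto)
  have int2: "integrable M (\<lambda>\<omega>. ?Y j \<omega> * ?Y k \<omega>)" if "j \<in> {1..N}" "k \<in> {1..N}" for j k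
  proof (rule integrable_const_bound[of _ "B * B"])
    show "(\<lambda>\<omega>. ?Y j \<omega> * ?Y k \<omega>) \<in> borel_measurable M"
      using mY[OF that(1)] mY[OF that(2)] by simp
    have "B \<ge> 0" using bd[of 0] by linarith
    then show "AE \<omega> in M. norm (?Y j \<omega> * ?Y k \<omega>) \<le> B * B"
      using bd by (auto simp: abs_mult intro!: mult_mono)
  qed
  have cov: "expectation (\<lambda>\<omega>. ?Y j \<omega> * ?Y k \<omega>) = (if j = k then (LINT \<omega>|M0. (\<phi> (X0 \<omega>))\<^sup>2) else 0)"
    if jk: "j \<in> {1..N}" "k \<in> {1..N}" for j k
  proof (cases "j = k")
    case True
    then show ?thesis
      using iid_copies_expectation[OF M iid _ X0, of k "\<lambda>n. (\<phi> n)\<^sup>2"] jk by (simp add: power2_eq_square)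
  next
    case False
    have "indep_vars (\<lambda>_. borel) ?Y {j, k}"
      by (rule indep_vars_compose2[OF indep_vars_subset[of "\<lambda>_. count_space UNIV" X "{1..}"]])
        (use iid jk in \<open>auto simp: iid_copies_def\<close>)
    then have "expectation (\<lambda>\<omega>. \<Prod>i\<in>{j, k}. ?Y i \<omega>) = (\<Prod>i\<in>{j, k}. expectation (?Y i))"
      by (intro indep_vars_lebesgue_integral) (use int jk in auto)
    then show ?thesis
      using False iid_copies_expectation[OF M iid _ X0, of k \<phi>] jk mean by simp
  qed
  have sq: "(\<Sum>k=1..N. ?Y k \<omega>)\<^sup>2 = (\<Sum>j=1..N. \<Sum>k=1..N. ?Y j \<omega> * ?Y k \<omega>)" for \<omega>
    by (simp add: power2_eq_square sum_product)
  show "integrable M (\<lambda>\<omega>. (\<Sum>k=1..N. ?Y k \<omega>)\<^sup>2)"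
    unfolding sq by (intro Bochner_Integration.integrable_sum int2)
  have "expectation (\<lambda>\<omega>. (\<Sum>k=1..N. ?Y k \<omega>)\<^sup>2) = (\<Sum>j=1..N. \<Sum>k=1..N. expectation (\<lambda>\<omega>. ?Y j \<omega> * ?Y k \<omega>))"
    unfolding sq
    by (subst Bochner_Integration.integral_sum, intro Bochner_Integration.integrable_sum int2, assumption+)
      (intro sum.cong refl Bochner_Integration.integral_sum int2)
  also have "\<dots> = (\<Sum>j=1..N. \<Sum>k=1..N. if j = k then (LINT \<omega>|M0. (\<phi> (X0 \<omega>))\<^sup>2) else 0)"
    by (intro sum.cong cov) auto
  also have "\<dots> = real N * (LINT \<omega>|M0. (\<phi> (X0 \<omega>))\<^sup>2)" by simp
  finally show "expectation (\<lambda>\<omega>. (\<Sum>k=1..N. ?Y k \<omega>)\<^sup>2) = real N * (LINT \<omega>|M0. (\<phi> (X0 \<omega>))\<^sup>2)" .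
qed

text \<open>The Bochner integral of a non-integrable function is 0, so a prescribed covariance
  carries no integrability; that has to come from the Gaussian law.\<close>

lemma (in prob_space) is_gaussian_square_integrable:
  assumes "is_gaussian M Z"
  shows "integrable M (\<lambda>\<omega>. (Z \<omega>)\<^sup>2)"
proof -
  have Z[measurable]: "Z \<in> borel_measurable M" using assms by (simp add: is_gaussian_def)
  from assms consider \<mu> where "AE \<omega> in M. Z \<omega> = \<mu>" |
    \<mu> \<sigma> where "\<sigma> > 0" "distributed M lborel Z (normal_density \<mu> \<sigma>)"
    by (auto simp: is_gaussian_def)
  then show ?thesis
  proof cases
    case 1
    then show ?thesis
      by (intro integrable_const_bound[of _ "\<mu>\<^sup>2"]) (auto elim: eventually_mono)
  next
    case 2
    have "integrable M (\<lambda>\<omega>. (Z \<omega> - \<mu>)\<^sup>2)"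
      using distributed_integrable[OF 2(2), of "\<lambda>x. (x - \<mu>)\<^sup>2"] integrable_normal_moment[of \<sigma> \<mu> 2] 2(1) by simp
    moreover from this have "integrable M (\<lambda>\<omega>. Z \<omega> - \<mu>)"
      by (rule square_integrable_imp_integrable[rotated]) simp
    ultimately have "integrable M (\<lambda>\<omega>. (Z \<omega> - \<mu>)\<^sup>2 + 2 * \<mu> * (Z \<omega> - \<mu>) + \<mu>\<^sup>2)" by simp
    also have "(\<lambda>\<omega>. (Z \<omega> - \<mu>)\<^sup>2 + 2 * \<mu> * (Z \<omega> - \<mu>) + \<mu>\<^sup>2) = (\<lambda>\<omega>. (Z \<omega>)\<^sup>2)"
      by (simp add: fun_eq_iff power2_eq_square algebra_simps)
    finally show ?thesis .
  qed
qed

text \<open>The first two moments determine the parameters, and a positive second moment with zero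
  mean excludes the degenerate law.\<close>

lemma (in prob_space) is_gaussian_centered:
  assumes Z: "is_gaussian M Z" and mean: "expectation Z = 0"
    and var: "expectation (\<lambda>\<omega>. (Z \<omega>)\<^sup>2) = \<sigma>\<^sup>2" and \<sigma>: "\<sigma> > 0"
  shows "distributed M lborel Z (normal_density 0 \<sigma>)"
proof -
  have mZ[measurable]: "Z \<in> borel_measurable M" using Z by (simp add: is_gaussian_def)
  from Z consider \<mu> where "AE \<omega> in M. Z \<omega> = \<mu>" |
    \<mu> v where "v > 0" "distributed M lborel Z (normal_density \<mu> v)"
    by (auto simp: is_gaussian_def)
  then show ?thesis
  proof cases
    case 1
    then have "expectation Z = expectation (\<lambda>_. \<mu>)" by (intro integral_cong_AE) auto
    then have "\<mu> = 0" using mean by (simp add: prob_space)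
    then have "expectation (\<lambda>\<omega>. (Z \<omega>)\<^sup>2) = expectation (\<lambda>_. 0)"
      using 1 by (intro integral_cong_AE) auto
    then show ?thesis using var \<sigma> by simp
  next
    case 2
    have "\<mu> = 0" using normal_distributed_expectation[OF 2] mean by simp
    moreover have "v\<^sup>2 = \<sigma>\<^sup>2"
      using normal_distributed_variance[OF 2] var mean by simp
    then have "v = \<sigma>" using 2(1) \<sigma> by simp
    ultimately show ?thesis using 2(2) by simp
  qed
qed

text \<open>The one-dimensional input of a Cramer-Wold argument, with \<open>\<phi>\<close> a linear
  statistic of one observation. The test functions are cosines because trigonometric sums are built
  from them. Zero variance is treated apart, since the central limit theorem divides by the standard
  deviation.\<close>

lemma iid_copies_clt:
  fixes \<phi> :: "nat \<Rightarrow> real"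
  assumes M0: "prob_space M0" and X0: "X0 \<in> measurable M0 (count_space UNIV)"
    and M: "prob_space M" and iid: "iid_copies M X M0 X0"
    and M': "prob_space M'" and Z: "is_gaussian M' Z"
    and bd: "\<And>n. \<bar>\<phi> n\<bar> \<le> B"
    and mean: "(LINT \<omega>|M0. \<phi> (X0 \<omega>)) = 0" "(LINT \<omega>|M'. Z \<omega>) = 0"
    and var: "(LINT \<omega>|M'. (Z \<omega>)\<^sup>2) = (LINT \<omega>|M0. (\<phi> (X0 \<omega>))\<^sup>2)"
  shows "(\<lambda>N. LINT \<omega>|M. cos (a + (\<Sum>k=1..N. \<phi> (X k \<omega>)) / sqrt (real N)))
     \<longlonglongrightarrow> (LINT \<omega>|M'. cos (a + Z \<omega>))"
proof -
  interpret M0: prob_space M0 by fact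
  interpret prob_space M by fact
  interpret M': prob_space M' by fact
  have Zm[measurable]: "Z \<in> borel_measurable M'" using Z by (simp add: is_gaussian_def)
  define v where "v = (LINT \<omega>|M0. (\<phi> (X0 \<omega>))\<^sup>2)"
  have v: "v \<ge> 0" by (simp add: v_def)
  have mY: "(\<lambda>\<omega>. \<phi> (X k \<omega>)) \<in> borel_measurable M" if "k \<ge> 1" for k
    by (rule measurable_comp_count_space[OF iid_copies_measurable[OF M iid that]])
  have B2: "(\<phi> n)\<^sup>2 \<le> B\<^sup>2" for n using bd[of n] by (metis abs_ge_zero power2_abs power_mono)
  have int2: "integrable M (\<lambda>\<omega>. (\<phi> (X k \<omega>))\<^sup>2)" if "k \<ge> 1" for k
    by (rule integrable_const_bound[of _ "B\<^sup>2"]) (use mY[OF that] B2 in auto)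
  have E2: "expectation (\<lambda>\<omega>. (\<phi> (X k \<omega>))\<^sup>2) = v" if "k \<ge> 1" for k
    using iid_copies_expectation[OF M iid that X0, of "\<lambda>n. (\<phi> n)\<^sup>2"] by (simp add: v_def)
  show ?thesis
  proof (cases "v = 0")
    case True
    \<comment> \<open>Every summand and the limit vanish almost surely, so both sides reduce to
      \<open>cos a\<close>.\<close>
    have Y0: "AE \<omega> in M. \<phi> (X k \<omega>) = 0" if "k \<ge> 1" for k
      using integral_nonneg_eq_0_iff_AE[OF int2[OF that]] E2[OF that] True by simp
    have S0: "AE \<omega> in M. (\<Sum>k=1..N. \<phi> (X k \<omega>)) = 0" for N
    proof -
      have "AE \<omega> in M. \<forall>k\<in>{1..N}. \<phi> (X k \<omega>) = 0" by (intro AE_finite_allI) (use Y0 in auto)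
      then show ?thesis by eventually_elim simp
    qed
    have "expectation (\<lambda>\<omega>. cos (a + (\<Sum>k=1..N. \<phi> (X k \<omega>)) / sqrt (real N))) = expectation (\<lambda>_. cos a)" for N
    proof (intro integral_cong_AE)
      have "(\<lambda>\<omega>. \<Sum>k=1..N. \<phi> (X k \<omega>)) \<in> borel_measurable M"
        by (rule borel_measurable_sum) (use mY in auto)
      then show "(\<lambda>\<omega>. cos (a + (\<Sum>k=1..N. \<phi> (X k \<omega>)) / sqrt (real N))) \<in> borel_measurable M"
        by simp
      show "AE \<omega> in M. cos (a + (\<Sum>k=1..N. \<phi> (X k \<omega>)) / sqrt (real N)) = cos a"
        using S0[of N] by eventually_elim simp
    qed simp
    moreover have "AE \<omega> in M'. Z \<omega> = 0"
      using integral_nonneg_eq_0_iff_AE[OF M'.is_gaussian_square_integrable[OF Z]] var True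
      by (simp add: v_def)
    then have "(LINT \<omega>|M'. cos (a + Z \<omega>)) = (LINT \<omega>|M'. cos a)"
      by (intro integral_cong_AE) auto
    ultimately show ?thesis by (simp add: prob_space M'.prob_space)
  next
    case False
    define \<sigma> where "\<sigma> = sqrt v"
    have \<sigma>: "\<sigma> > 0" "\<sigma>\<^sup>2 = v" using False v by (auto simp: \<sigma>_def)
    let ?S = "\<lambda>N \<omega>. (\<Sum>i<N. \<phi> (X (Suc i) \<omega>)) / sqrt (real N * \<sigma>\<^sup>2)"
    have mS: "?S N \<in> borel_measurable M" for N using mY by simp
    have "weak_conv_m (\<lambda>N. distr M borel (?S N)) std_normal_distribution"
    proof (rule central_limit_theorem_zero_mean[where \<mu> = "distr M0 borel (\<lambda>\<omega>. \<phi> (X0 \<omega>))"])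
      show "indep_vars (\<lambda>i. borel) (\<lambda>i \<omega>. \<phi> (X (Suc i) \<omega>)) UNIV"
        by (rule indep_vars_compose2[OF indep_vars_Suc])
          (use iid in \<open>auto simp: iid_copies_def\<close>)
      show E0: "expectation (\<lambda>\<omega>. \<phi> (X (Suc n) \<omega>)) = 0" for n
        using iid_copies_expectation[OF M iid _ X0, of "Suc n" \<phi>] mean by simp
      show "variance (\<lambda>\<omega>. \<phi> (X (Suc n) \<omega>)) = \<sigma>\<^sup>2" for n
        using E2[of "Suc n"] \<sigma> unfolding E0 by simp
      show "distr M borel (\<lambda>\<omega>. \<phi> (X (Suc n) \<omega>)) = distr M0 borel (\<lambda>\<omega>. \<phi> (X0 \<omega>))" for n
      proof -
        have "distr M borel (\<lambda>\<omega>. \<phi> (X (Suc n) \<omega>)) = distr (distr M (count_space UNIV) (X (Suc n))) borel \<phi>"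
          using iid_copies_measurable[OF M iid, of "Suc n"] by (subst distr_distr) (auto simp: comp_def)
        also have "\<dots> = distr (distr M0 (count_space UNIV) X0) borel \<phi>"
          using iid by (simp add: iid_copies_def)
        also have "\<dots> = distr M0 borel (\<lambda>\<omega>. \<phi> (X0 \<omega>))"
          using X0 by (subst distr_distr) (auto simp: comp_def)
        finally show ?thesis .
      qed
    qed (use \<sigma> int2 in auto)
    \<comment> \<open>The factor \<open>\<sigma>\<close> in the test function undoes the
      standardisation.\<close>
    then have "(\<lambda>N. integral\<^sup>L (distr M borel (?S N)) (\<lambda>x. cos (a + \<sigma> * x)))
        \<longlonglongrightarrow> integral\<^sup>L std_normal_distribution (\<lambda>x. cos (a + \<sigma> * x))"
      by (intro weak_conv_imp_integral_bdd_continuous_conv[where B = 1] real_dist_normal_dist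
          real_distribution_distr mS) (auto intro!: continuous_intros)
    moreover have "integral\<^sup>L (distr M borel (?S N)) (\<lambda>x. cos (a + \<sigma> * x)) =
        (LINT \<omega>|M. cos (a + (\<Sum>k=1..N. \<phi> (X k \<omega>)) / sqrt (real N)))" for N
    proof -
      have "(\<Sum>k=1..N. \<phi> (X k \<omega>)) = (\<Sum>i<N. \<phi> (X (Suc i) \<omega>))" for \<omega>
        by (rule sum.reindex_bij_witness[of _ Suc "\<lambda>k. k - 1"]) auto
      moreover have "\<sigma> * (s / sqrt (real N * \<sigma>\<^sup>2)) = s / sqrt (real N)" for s
        using \<sigma>(1) by (simp add: real_sqrt_mult)
      ultimately show ?thesis using mS by (subst integral_distr) auto
    qed
    moreover have "integral\<^sup>L std_normal_distribution (\<lambda>x. cos (a + \<sigma> * x)) = (LINT \<omega>|M'. cos (a + Z \<omega>))"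
    proof -
      have "distributed M' lborel Z (normal_density 0 \<sigma>)"
        by (rule M'.is_gaussian_centered[OF Z mean(2) _ \<sigma>(1)]) (simp add: var \<sigma> v_def)
      then have D: "distributed M' lborel (\<lambda>\<omega>. Z \<omega> / \<sigma>) std_normal_density"
        using M'.normal_standard_normal_convert[OF \<sigma>(1), of Z 0] by simp
      have "integral\<^sup>L std_normal_distribution (\<lambda>x. cos (a + \<sigma> * x)) =
          (\<integral>x. std_normal_density x * cos (a + \<sigma> * x) \<partial>lborel)"
        by (subst integral_density) auto
      also have "\<dots> = (LINT \<omega>|M'. cos (a + \<sigma> * (Z \<omega> / \<sigma>)))"
        by (rule distributed_integral[OF D]) auto
      finally show ?thesis using \<sigma>(1) by simp
    qed
    ultimately show ?thesis by simp
  qed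
qed

text \<open>Total probability over the values of \<open>W\<close>. The conditional law is prescribed
  only where \<open>W\<close> has positive mass; elsewhere the summand and the joint probability are
  both 0.\<close>

lemma (in prob_space) pmass_thinning_sums:
  assumes W: "W \<in> measurable M (count_space UNIV)" and Wq: "Wq \<in> measurable M (count_space UNIV)"
    and thin: "has_binomial_thinning M q W Wq" and q: "0 \<le> q" "q \<le> 1"
  shows "(\<lambda>w. pmass M W w * (real (w choose s) * q ^ s * (1 - q) ^ (w - s))) sums pmass M Wq s"
proof -
  let ?A = "\<lambda>w. {\<omega> \<in> space M. Wq \<omega> = s \<and> W \<omega> = w}"
  have mA: "?A w \<in> events" for w
  proof -
    have "?A w = (Wq -` {s} \<inter> space M) \<inter> (W -` {w} \<inter> space M)" by auto
    then show ?thesis using measurable_sets[OF W, of "{w}"] measurable_sets[OF Wq, of "{s}"] by auto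
  qed
  have mW: "{\<omega> \<in> space M. W \<omega> = w} \<in> events" for w
    using measurable_sets[OF W, of "{w}"] by (simp add: vimage_def Int_def conj_commute)
  have "prob (?A w) = pmass M W w * (real (w choose s) * q ^ s * (1 - q) ^ (w - s))" for w
  proof (cases "pmass M W w > 0")
    case True
    then have "\<P>(\<omega> in M. Wq \<omega> = s \<bar> W \<omega> = w) = pmf (binomial_pmf w q) s"
      using thin by (simp add: has_binomial_thinning_def)
    then show ?thesis using True q by (simp add: cond_prob_def pmass_def field_simps)
  next
    case False
    then have "pmass M W w = 0" by (simp add: pmass_def zero_less_measure_iff)
    moreover have "prob (?A w) \<le> pmass M W w"
      unfolding pmass_def by (rule finite_measure_mono) (use mW in auto)
    ultimately show ?thesis by (simp add: measure_le_0_iff)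
  qed
  moreover have "(\<lambda>w. prob (?A w)) sums prob (\<Union>w. ?A w)"
    by (rule finite_measure_UNION) (use mA in \<open>auto simp: disjoint_family_on_def\<close>)
  moreover have "(\<Union>w. ?A w) = {\<omega> \<in> space M. Wq \<omega> = s}" by auto
  ultimately show ?thesis by (simp add: pmass_def)
qed

subsection \<open>Fluctuations of the empirical distribution\<close>

text \<open>The expected weighted norm is at most the sum of \<open>w s * \<sigma> s\<close>. The
  computation runs in \<open>ennreal\<close>, since convergence of the series along a path is the
  very thing to be shown.\<close>

lemma (in prob_space) AE_weighted_l1:
  assumes X[measurable]: "\<And>s. (\<lambda>\<omega>. X \<omega> s) \<in> borel_measurable M"
    and sq: "\<And>s. integrable M (\<lambda>\<omega>. (X \<omega> s)\<^sup>2)"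
    and var: "\<And>s. expectation (\<lambda>\<omega>. (X \<omega> s)\<^sup>2) \<le> (\<sigma> s)\<^sup>2"
    and \<sigma>: "\<And>s. \<sigma> s \<ge> 0" and w: "\<And>s. w s \<ge> 0" and summ: "summable (\<lambda>s. w s * \<sigma> s)"
  shows "AE \<omega> in M. X \<omega> \<in> weighted_l1 w"
proof -
  note abs = expectation_abs_le[OF X sq var \<sigma>]
  have "(\<integral>\<^sup>+\<omega>. (\<Sum>s. ennreal (w s * \<bar>X \<omega> s\<bar>)) \<partial>M) = (\<Sum>s. \<integral>\<^sup>+\<omega>. ennreal (w s * \<bar>X \<omega> s\<bar>) \<partial>M)"
    by (rule nn_integral_suminf) simp
  also have "\<dots> \<le> (\<Sum>s. ennreal (w s * \<sigma> s))"
  proof (intro suminf_le summableI)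
    fix s
    have "(\<integral>\<^sup>+\<omega>. ennreal (w s * \<bar>X \<omega> s\<bar>) \<partial>M) = ennreal (expectation (\<lambda>\<omega>. w s * \<bar>X \<omega> s\<bar>))"
      by (rule nn_integral_eq_integral) (use abs(1) w in auto)
    also have "\<dots> \<le> ennreal (w s * \<sigma> s)"
      using abs(2)[of s] w by (intro ennreal_leI) (auto intro: mult_left_mono)
    finally show "(\<integral>\<^sup>+\<omega>. ennreal (w s * \<bar>X \<omega> s\<bar>) \<partial>M) \<le> ennreal (w s * \<sigma> s)" .
  qed
  also have "\<dots> < top"
    using summ w \<sigma> by (simp add: ennreal_suminf_neq_top less_top)
  finally have "AE \<omega> in M. (\<Sum>s. ennreal (w s * \<bar>X \<omega> s\<bar>)) \<noteq> \<infinity>"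
    by (intro nn_integral_PInf_AE) auto
  then show ?thesis
    by eventually_elim (use w in \<open>auto simp: weighted_l1_def intro!: summable_suminf_not_top\<close>)
qed

text \<open>Applied to the Gaussian process and to the centred indicators: equal covariances then
  give equal second moments of linear forms, as the limit theorem asks.\<close>

lemma expectation_sum_square:
  fixes X :: "'i \<Rightarrow> 'a \<Rightarrow> real"
  assumes "\<And>i j. i \<in> F \<Longrightarrow> j \<in> F \<Longrightarrow> integrable M (\<lambda>\<omega>. X i \<omega> * X j \<omega>)"
  shows "(LINT \<omega>|M. (\<Sum>i\<in>F. c i * X i \<omega>)\<^sup>2) = (\<Sum>i\<in>F. \<Sum>j\<in>F. c i * c j * (LINT \<omega>|M. X i \<omega> * X j \<omega>))"
proof -
  have sq: "(\<Sum>i\<in>F. c i * X i \<omega>)\<^sup>2 = (\<Sum>i\<in>F. \<Sum>j\<in>F. c i * c j * (X i \<omega> * X j \<omega>))" for \<omega>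
    by (simp add: power2_eq_square sum_product mult_ac)
  have int: "integrable M (\<lambda>\<omega>. c i * c j * (X i \<omega> * X j \<omega>))" if "i \<in> F" "j \<in> F" for i j
    using assms[OF that] by (rule integrable_mult_right)
  have "(LINT \<omega>|M. (\<Sum>i\<in>F. c i * X i \<omega>)\<^sup>2) = (\<Sum>i\<in>F. \<Sum>j\<in>F. LINT \<omega>|M. c i * c j * (X i \<omega> * X j \<omega>))"
    unfolding sq
    by (subst Bochner_Integration.integral_sum, intro Bochner_Integration.integrable_sum int, assumption+)
      (intro sum.cong refl Bochner_Integration.integral_sum int)
  then show ?thesis by simp
qed

text \<open>The events \<open>X = s\<close> and \<open>X = t\<close> are disjoint unless
  \<open>s = t\<close>. The result is the covariance of a single multinomial trial, which is the one
  prescribed for \<open>\<xi>\<close>.\<close>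

lemma (in prob_space)
  assumes X: "X \<in> measurable M (count_space UNIV)"
  shows expectation_point_indicator: "expectation (\<lambda>\<omega>. (if X \<omega> = s then 1 else 0) - pmass M X s) = 0"
    and expectation_point_covariance: "expectation (\<lambda>\<omega>. ((if X \<omega> = s then 1 else 0) - pmass M X s) *
        ((if X \<omega> = t then 1 else 0) - pmass M X t)) =
      pmass M X s * (if s = t then 1 else 0) - pmass M X s * pmass M X t"
proof -
  have ev: "{\<omega> \<in> space M. X \<omega> = s} \<in> events" for s
    using measurable_sets[OF X, of "{s}"] by (simp add: vimage_def Int_def conj_commute)
  let ?I = "\<lambda>s. indicator {\<omega> \<in> space M. X \<omega> = s} :: 'a \<Rightarrow> real"
  have I: "expectation (?I s) = pmass M X s" "integrable M (?I s)" for s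
    using ev by (simp_all add: pmass_def emeasure_eq_measure)
  have "expectation (\<lambda>\<omega>. (if X \<omega> = s then 1 else 0) - pmass M X s) = expectation (\<lambda>\<omega>. ?I s \<omega> - pmass M X s)"
    by (intro Bochner_Integration.integral_cong) auto
  then show "expectation (\<lambda>\<omega>. (if X \<omega> = s then 1 else 0) - pmass M X s) = 0"
    using I by (simp add: prob_space)
  have "expectation (\<lambda>\<omega>. ((if X \<omega> = s then 1 else 0) - pmass M X s) *
        ((if X \<omega> = t then 1 else 0) - pmass M X t)) =
      expectation (\<lambda>\<omega>. (if s = t then 1 else 0) * ?I s \<omega> - pmass M X t * ?I s \<omega> - pmass M X s * ?I t \<omega>
        + pmass M X s * pmass M X t)"
    by (intro Bochner_Integration.integral_cong) (auto simp: algebra_simps)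
  also have "\<dots> = pmass M X s * (if s = t then 1 else 0) - pmass M X s * pmass M X t"
    using I by (simp add: prob_space)
  finally show "expectation (\<lambda>\<omega>. ((if X \<omega> = s then 1 else 0) - pmass M X s) *
        ((if X \<omega> = t then 1 else 0) - pmass M X t)) =
      pmass M X s * (if s = t then 1 else 0) - pmass M X s * pmass M X t" .
qed

text \<open>The normalised sum to which the limit theorem applies. At \<open>N = 0\<close> both
  sides are 0, since \<open>sqrt 0 = 0\<close> and division by 0 yields 0.\<close>

lemma emp_pmf_fluctuation:
  "sqrt (real N) * (emp_pmf X N \<omega> s - p) = (\<Sum>k=1..N. (if X k \<omega> = s then 1 else 0) - p) / sqrt (real N)"
proof (cases "N = 0")
  case False
  have "sqrt (real N) * (emp_pmf X N \<omega> s - p) =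
      sqrt (real N) * ((\<Sum>k=1..N. (if X k \<omega> = s then 1 else 0) - p) / real N)"
    using False by (simp add: emp_pmf_def sum_subtractf diff_divide_distrib)
  also have "\<dots> = (\<Sum>k=1..N. (if X k \<omega> = s then 1 else 0) - p) / sqrt (real N)"
    using False by (simp add: real_div_sqrt divide_simps flip: power2_eq_square)
  finally show ?thesis .
qed simp

lemma emp_pmf_in_weighted_l1: "emp_pmf X N \<omega> \<in> weighted_l1 w"
  unfolding weighted_l1_def mem_Collect_eq
proof (rule summable_finite[of "(\<lambda>k. X k \<omega>) ` {1..N}"])
  fix s assume "s \<notin> (\<lambda>k. X k \<omega>) ` {1..N}"
  then have "(\<Sum>k=1..N. if X k \<omega> = s then 1 else 0 :: real) = 0" by (intro sum.neutral) auto
  then show "w s * \<bar>emp_pmf X N \<omega> s\<bar> = 0" by (simp add: emp_pmf_def)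
qed simp

text \<open>The series at index \<open>n\<close> starts with \<open>x n\<close>, so for
  \<open>n \<ge> 1\<close> coordinate 0 may be altered freely.\<close>

lemma S_op_cong: "(\<And>s. s \<ge> n \<Longrightarrow> x s = y s) \<Longrightarrow> S_op q x n = S_op q y n"
  by (simp add: S_op_def S_term_def)

lemma weighted_l1_le:
  assumes "y \<in> weighted_l1 w" "\<And>s. w s \<ge> 0" "\<And>s. \<bar>x s\<bar> \<le> c * \<bar>y s\<bar>"
  shows "x \<in> weighted_l1 w"
proof -
  have "summable (\<lambda>s. c * (w s * \<bar>y s\<bar>))"
    using assms(1) by (intro summable_mult) (simp add: weighted_l1_def)
  then show ?thesis unfolding weighted_l1_def mem_Collect_eq
  proof (rule summable_comparison_test'[of _ 0])
    fix s show "norm (w s * \<bar>x s\<bar>) \<le> c * (w s * \<bar>y s\<bar>)"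
      using mult_left_mono[OF assms(3,2), of s s] assms(2)[of s] by (simp add: mult_ac)
  qed
qed

text \<open>The limit is a version \<open>Y\<close> of \<open>S(\<xi>)\<close>: the series is known
  to converge, with values in \<open>linf b\<close>, only outside a null set, whereas convergence in
  distribution asks for a map that is measurable into the space everywhere.\<close>

theorem proposition4p5:
  fixes q b b' :: real
    and M0 :: "'a measure" and W Wq :: "'a \<Rightarrow> nat"
    and M :: "'b measure" and Wqs :: "nat \<Rightarrow> 'b \<Rightarrow> nat"
    and M' :: "'c measure" and \<xi> :: "nat \<Rightarrow> 'c \<Rightarrow> real"
  assumes q: "0 < q" "q < 1"
    and M0: "prob_space M0"
    and W: "W \<in> measurable M0 (count_space UNIV)" "\<forall>\<omega>\<in>space M0. W \<omega> \<ge> 1"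
    and Wq: "Wq \<in> measurable M0 (count_space UNIV)" "has_binomial_thinning M0 q W Wq"
    and M: "prob_space M"
    and Wqs: "iid_copies M Wqs M0 Wq"
    and M': "prob_space M'"
    and gauss: "gaussian_process M' {1..} \<xi>"
    and mean: "\<forall>s\<ge>1. (LINT \<omega>|M'. \<xi> s \<omega>) = 0"
    and cov: "\<forall>s1\<ge>1. \<forall>s2\<ge>1. (LINT \<omega>|M'. \<xi> s1 \<omega> * \<xi> s2 \<omega>) =
                 pmass M0 Wq s1 * (if s1 = s2 then 1 else 0) - pmass M0 Wq s1 * pmass M0 Wq s2"
    and b': "b' > 0"
    and summ: "summable (\<lambda>s. sqrt (pmass M0 Wq s) * ((b' + 1 - q) / q) ^ s)"
    and b: "0 < b" "b < b'"
  shows "(AE \<omega> in M'. \<forall>n\<ge>1. summable (S_term q (\<lambda>s. \<xi> s \<omega>) n)) \<and>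
    (\<exists>Y. (AE \<omega> in M'. Y \<omega> = (S_op q (\<lambda>s. \<xi> s \<omega>))(0 := 0)) \<and>
         tends_in_distribution (linf_top b)
           M (\<lambda>N \<omega>. (\<lambda>w. sqrt (real N) * (S_op q (emp_pmf Wqs N \<omega>) w - pmass M0 W w))(0 := 0))
           M' Y)"
proof -
  interpret M0: prob_space M0 by fact
  interpret M: prob_space M by fact
  interpret M': prob_space M' by fact

  \<comment> \<open>Weights, moment bounds and inversion of the thinning\<close>
  define f where "f = pmass M0 Wq"
  define w where "w = (\<lambda>s. ((b' + 1 - q) / q) ^ s)"
  define \<sigma> where "\<sigma> = (\<lambda>s. sqrt (f s))"
  have w: "w s \<ge> 0" for s using q b' by (simp add: w_def)
  have f: "0 \<le> f s" "f s \<le> 1" for s by (auto simp: f_def pmass_def)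
  have \<sigma>: "\<sigma> s \<ge> 0" "(\<sigma> s)\<^sup>2 = f s" for s using f by (auto simp: \<sigma>_def)
  have f\<sigma>: "f s \<le> \<sigma> s" for s
  proof -
    have "\<sigma> s * \<sigma> s \<le> \<sigma> s" using \<sigma>(1)[of s] f[of s] by (intro mult_left_le) (auto simp: \<sigma>_def)
    then show ?thesis using \<sigma>(2)[of s] by (simp add: power2_eq_square)
  qed
  have w\<sigma>: "summable (\<lambda>s. w s * \<sigma> s)"
    using summ by (simp add: w_def \<sigma>_def f_def mult.commute)
  have "\<sigma> \<in> weighted_l1 w" using w\<sigma> \<sigma>(1) by (simp add: weighted_l1_def)
  \<comment> \<open>As \<open>f \<le> 1\<close>, the law \<open>f\<close> lies below its square root
    and inherits the weighted summability, so that \<open>S\<close> may be applied to it.\<close>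
  then have fl: "f \<in> weighted_l1 w"
    by (rule weighted_l1_le[where c = 1, OF _ w]) (use f\<sigma> f \<sigma>(1) in auto)
  have thin: "(\<lambda>v. pmass M0 W v * (real (v choose s) * q ^ s * (1 - q) ^ (v - s))) sums f s" for s
    unfolding f_def by (rule M0.pmass_thinning_sums[OF W(1) Wq]) (use q in auto)
  have g0: "pmass M0 W v \<ge> 0" for v by (simp add: pmass_def)
  have Sf: "S_op q f n = pmass M0 W n" for n
    by (rule S_op_thinning[OF q b' g0 thin fl[unfolded w_def]])
  note S_summable = summable_S_term[OF q b', folded w_def]
  have S_linf: "(S_op q x)(0 := 0) \<in> linf b" if "x \<in> weighted_l1 w" for x
    by (rule S_op_in_linf[OF q b(1) less_imp_le[OF b(2)]]) (use that in \<open>simp add: w_def\<close>)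

  \<comment> \<open>The Gaussian limit as a random element of the weighted space\<close>
  define X where "X = (\<lambda>\<omega> s. if s = 0 then 0 else \<xi> s \<omega>)"
  have gF: "is_gaussian M' (\<lambda>\<omega>. \<Sum>i\<in>F. c i * \<xi> i \<omega>)" if "finite F" "F \<subseteq> {1..}" for F c
    using gauss that by (simp add: gaussian_process_def)
  have g\<xi>: "is_gaussian M' (\<xi> s)" if "s \<ge> 1" for s
    using gF[of "{s}" "\<lambda>_. 1"] that by simp
  have m\<xi>: "\<xi> s \<in> borel_measurable M'" if "s \<ge> 1" for s
    using g\<xi>[OF that] by (simp add: is_gaussian_def)
  have sq\<xi>: "integrable M' (\<lambda>\<omega>. (\<xi> s \<omega>)\<^sup>2)" if "s \<ge> 1" for s
    by (rule M'.is_gaussian_square_integrable[OF g\<xi>[OF that]])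
  have mX: "(\<lambda>\<omega>. X \<omega> s) \<in> borel_measurable M'" for s
    using m\<xi>[of s] by (cases "s = 0") (auto simp: X_def)
  have sqX: "integrable M' (\<lambda>\<omega>. (X \<omega> s)\<^sup>2)" for s
    using sq\<xi>[of s] by (cases "s = 0") (auto simp: X_def)
  have varX: "(LINT \<omega>|M'. (X \<omega> s)\<^sup>2) \<le> (\<sigma> s)\<^sup>2" for s
  proof (cases "s = 0")
    case False
    then have "(LINT \<omega>|M'. (X \<omega> s)\<^sup>2) = f s - f s * f s"
      using cov[rule_format, of s s] by (simp add: X_def f_def power2_eq_square)
    then show ?thesis using f[of s] by (simp add: \<sigma>)
  qed (use f in \<open>simp add: X_def \<sigma>\<close>)
  have "AE \<omega> in M'. X \<omega> \<in> weighted_l1 w"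
    by (rule M'.AE_weighted_l1[OF mX sqX varX \<sigma>(1) w w\<sigma>])
  then obtain E where E: "E \<in> null_sets M'" "\<And>\<omega>. \<omega> \<in> space M' \<Longrightarrow> \<omega> \<notin> E \<Longrightarrow> X \<omega> \<in> weighted_l1 w"
    by (auto elim!: AE_E)
  \<comment> \<open>A version whose paths all lie in the weighted space, as the measurability and
    convergence lemmas ask; the zero sequence is used on the exceptional null set.\<close>
  define Z where "Z = (\<lambda>\<omega> s. if \<omega> \<in> E then 0 else X \<omega> s)"
  have ZX: "AE \<omega> in M'. Z \<omega> = X \<omega>"
    using AE_not_in[OF E(1)] by eventually_elim (simp add: Z_def)
  have mZ: "(\<lambda>\<omega>. Z \<omega> s) \<in> borel_measurable M'" for s
  proof -
    have [measurable]: "E \<in> sets M'" using E(1) by auto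
    note mX[measurable]
    show ?thesis unfolding Z_def by measurable
  qed
  have lZ: "Z \<omega> \<in> weighted_l1 w" if "\<omega> \<in> space M'" for \<omega>
  proof (cases "\<omega> \<in> E")
    case True
    then show ?thesis by (simp add: Z_def weighted_l1_def)
  next
    case False
    then show ?thesis using E(2)[OF that] by (simp add: Z_def)
  qed
  have sqZ: "integrable M' (\<lambda>\<omega>. (Z \<omega> s)\<^sup>2)" "(LINT \<omega>|M'. (Z \<omega> s)\<^sup>2) \<le> (\<sigma> s)\<^sup>2" for s
  proof -
    have ae: "AE \<omega> in M'. (X \<omega> s)\<^sup>2 = (Z \<omega> s)\<^sup>2" using ZX by eventually_elim simp
    have m: "(\<lambda>\<omega>. (X \<omega> s)\<^sup>2) \<in> borel_measurable M'" "(\<lambda>\<omega>. (Z \<omega> s)\<^sup>2) \<in> borel_measurable M'"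
      using mX mZ by auto
    show "integrable M' (\<lambda>\<omega>. (Z \<omega> s)\<^sup>2)"
      using integrable_cong_AE[OF m ae] sqX by simp
    show "(LINT \<omega>|M'. (Z \<omega> s)\<^sup>2) \<le> (\<sigma> s)\<^sup>2"
      using integral_cong_AE[OF m ae] varX[of s] by simp
  qed

  \<comment> \<open>Empirical fluctuations in the weighted space\<close>
  define \<psi> where "\<psi> = (\<lambda>s n. (if n = s then 1 else 0) - f s :: real)"
  have \<psi>1: "\<bar>\<psi> s n\<bar> \<le> 1" for s n using f[of s] by (auto simp: \<psi>_def)
  have E\<psi>: "(LINT \<omega>|M0. \<psi> s (Wq \<omega>)) = 0" for s
    using M0.expectation_point_indicator[OF Wq(1), of s] by (simp add: \<psi>_def f_def)
  have E\<psi>\<psi>: "(LINT \<omega>|M0. \<psi> s (Wq \<omega>) * \<psi> t (Wq \<omega>)) = f s * (if s = t then 1 else 0) - f s * f t" for s t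
    using M0.expectation_point_covariance[OF Wq(1), of s t] by (simp add: \<psi>_def f_def)
  \<comment> \<open>Coordinate 0 is cleared to match \<open>X\<close>; otherwise \<open>V\<close>
    would have a fluctuation there that the limit lacks.\<close>
  define V where "V = (\<lambda>N \<omega> s. if s = 0 then 0 else sqrt (real N) * (emp_pmf Wqs N \<omega> s - f s))"
  have V: "V N \<omega> s = (\<Sum>k=1..N. \<psi> s (Wqs k \<omega>)) / sqrt (real N)" if "s \<ge> 1" for N \<omega> s
    using that emp_pmf_fluctuation[of N Wqs \<omega> s "f s"] by (simp add: V_def \<psi>_def)
  have mV: "(\<lambda>\<omega>. V N \<omega> s) \<in> borel_measurable M" for N s
  proof (cases "s = 0")
    case False
    have "(\<lambda>\<omega>. \<Sum>k=1..N. \<psi> s (Wqs k \<omega>)) \<in> borel_measurable M"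
      by (intro borel_measurable_sum measurable_comp_count_space iid_copies_measurable[OF M Wqs]) auto
    then show ?thesis using False by (simp add: V)
  qed (simp add: V_def)
  have sqV: "integrable M (\<lambda>\<omega>. (V N \<omega> s)\<^sup>2)" "(LINT \<omega>|M. (V N \<omega> s)\<^sup>2) \<le> (\<sigma> s)\<^sup>2" for N s
  proof -
    have "integrable M (\<lambda>\<omega>. (V N \<omega> s)\<^sup>2) \<and> (LINT \<omega>|M. (V N \<omega> s)\<^sup>2) \<le> (\<sigma> s)\<^sup>2"
    proof (cases "s = 0")
      case True
      then show ?thesis using f by (simp add: V_def \<sigma>)
    next
      case False
      have V2: "(V N \<omega> s)\<^sup>2 = (\<Sum>k=1..N. \<psi> s (Wqs k \<omega>))\<^sup>2 / real N" for \<omega>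
        using False by (simp add: V power_divide)
      note S = iid_copies_sum_square[OF M Wqs Wq(1), of "\<psi> s", OF \<psi>1 E\<psi>, of N]
      have "(LINT \<omega>|M. (V N \<omega> s)\<^sup>2) = real N * (f s - f s * f s) / real N"
        unfolding V2 using S(2) E\<psi>\<psi>[of s s] by (simp add: power2_eq_square)
      also have "\<dots> \<le> (\<sigma> s)\<^sup>2" using f[of s] by (cases "N = 0") (auto simp: \<sigma>)
      finally show ?thesis using S(1) unfolding V2 by simp
    qed
    then show "integrable M (\<lambda>\<omega>. (V N \<omega> s)\<^sup>2)" "(LINT \<omega>|M. (V N \<omega> s)\<^sup>2) \<le> (\<sigma> s)\<^sup>2" by auto
  qed
  have diff: "(\<lambda>s. emp_pmf Wqs N \<omega> s - f s) \<in> weighted_l1 w" for N \<omega>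
    by (rule weighted_l1_diff[OF w emp_pmf_in_weighted_l1 fl])
  have lV: "V N \<omega> \<in> weighted_l1 w" for N \<omega>
    by (rule weighted_l1_le[where c = "sqrt (real N)", OF diff[of N \<omega>] w]) (auto simp: V_def abs_mult)
  \<comment> \<open>Centring at \<open>f\<close> becomes centring at the law of \<open>W\<close>,
    because \<open>S_op q f\<close> is that law.\<close>
  have SV: "(\<lambda>n. sqrt (real N) * (S_op q (emp_pmf Wqs N \<omega>) n - pmass M0 W n))(0 := 0) =
      (S_op q (V N \<omega>))(0 := 0)" for N \<omega>
  proof -
    have "S_op q (V N \<omega>) n = sqrt (real N) * (S_op q (emp_pmf Wqs N \<omega>) n - pmass M0 W n)" if "n \<ge> 1" for n
    proof -
      have "S_op q (V N \<omega>) n = S_op q (\<lambda>s. sqrt (real N) * (emp_pmf Wqs N \<omega> s - f s)) n"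
        by (rule S_op_cong) (use that in \<open>auto simp: V_def\<close>)
      also have "\<dots> = sqrt (real N) * S_op q (\<lambda>s. emp_pmf Wqs N \<omega> s - f s) n"
        by (rule S_op_scale[OF S_summable[OF diff]])
      also have "S_op q (\<lambda>s. emp_pmf Wqs N \<omega> s - f s) n = S_op q (emp_pmf Wqs N \<omega>) n - S_op q f n"
        by (rule S_op_diff[OF S_summable[OF emp_pmf_in_weighted_l1] S_summable[OF fl]])
      finally show ?thesis by (simp add: Sf)
    qed
    then show ?thesis by (auto simp: fun_eq_iff)
  qed

  \<comment> \<open>Joint convergence of finitely many coordinates\<close>
  have chars: "(\<lambda>N. LINT \<omega>|M. cos (a + (\<Sum>i<m. c i * V N \<omega> i)))
      \<longlonglongrightarrow> (LINT \<omega>|M'. cos (a + (\<Sum>i<m. c i * Z \<omega> i)))" for m a c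
  proof -
    \<comment> \<open>A linear form in the coordinates of \<open>V\<close> is a normalised sum of
      one function \<open>\<phi>\<close> over the observations, which makes it one-dimensional.
      Index 0 drops out because \<open>V\<close> and \<open>Z\<close> vanish there.\<close>
    define \<phi> where "\<phi> = (\<lambda>n. \<Sum>i\<in>{1..<m}. c i * \<psi> i n)"
    define G where "G = (\<lambda>\<omega>. \<Sum>i\<in>{1..<m}. c i * \<xi> i \<omega>)"
    have drop0: "(\<Sum>i<m. h i) = (\<Sum>i\<in>{1..<m}. h i)" if "h 0 = 0" for h :: "nat \<Rightarrow> real"
      using that by (intro sum.mono_neutral_right) (auto simp: not_le)
    have \<phi>B: "\<bar>\<phi> n\<bar> \<le> (\<Sum>i\<in>{1..<m}. \<bar>c i\<bar>)" for n
      unfolding \<phi>_def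
      by (rule order_trans[OF sum_abs sum_mono]) (use \<psi>1 in \<open>auto simp: abs_mult intro: mult_left_le\<close>)
    have m\<psi>: "(\<lambda>\<omega>. \<psi> i (Wq \<omega>)) \<in> borel_measurable M0" for i
      by (rule measurable_comp_count_space[OF Wq(1)])
    have i\<psi>: "integrable M0 (\<lambda>\<omega>. \<psi> i (Wq \<omega>))" for i
      by (rule M0.integrable_const_bound[of _ 1, OF _ m\<psi>]) (use \<psi>1 in auto)
    have i\<psi>\<psi>: "integrable M0 (\<lambda>\<omega>. \<psi> i (Wq \<omega>) * \<psi> j (Wq \<omega>))" for i j
      by (rule M0.integrable_const_bound[of _ 1])
        (use \<psi>1 m\<psi> in \<open>auto simp: abs_mult intro!: mult_le_one\<close>)
    have i\<xi>: "integrable M' (\<xi> i)" if "i \<ge> 1" for i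
      by (rule M'.square_integrable_imp_integrable[OF m\<xi>[OF that] sq\<xi>[OF that]])
    have i\<xi>\<xi>: "integrable M' (\<lambda>\<omega>. \<xi> i \<omega> * \<xi> j \<omega>)" if "i \<ge> 1" "j \<ge> 1" for i j
    proof (rule Bochner_Integration.integrable_bound)
      show "integrable M' (\<lambda>\<omega>. (\<xi> i \<omega>)\<^sup>2 + (\<xi> j \<omega>)\<^sup>2)" using sq\<xi> that by simp
      show "(\<lambda>\<omega>. \<xi> i \<omega> * \<xi> j \<omega>) \<in> borel_measurable M'" using m\<xi> that by simp
      have "\<bar>x * y\<bar> \<le> x\<^sup>2 + y\<^sup>2" for x y :: real
        using sum_squares_bound[of "\<bar>x\<bar>" "\<bar>y\<bar>"] abs_ge_zero[of "x * y"]
        unfolding abs_mult power2_abs by linarith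
      then show "AE \<omega> in M'. norm (\<xi> i \<omega> * \<xi> j \<omega>) \<le> norm ((\<xi> i \<omega>)\<^sup>2 + (\<xi> j \<omega>)\<^sup>2)" by simp
    qed
    have "(\<lambda>N. LINT \<omega>|M. cos (a + (\<Sum>k=1..N. \<phi> (Wqs k \<omega>)) / sqrt (real N)))
        \<longlonglongrightarrow> (LINT \<omega>|M'. cos (a + G \<omega>))"
    proof (rule iid_copies_clt[OF M0 Wq(1) M Wqs M' _ \<phi>B])
      show "is_gaussian M' G" unfolding G_def by (rule gF) auto
      show "(LINT \<omega>|M0. \<phi> (Wq \<omega>)) = 0" unfolding \<phi>_def using i\<psi> E\<psi> by simp
      show "(LINT \<omega>|M'. G \<omega>) = 0" unfolding G_def using i\<xi> mean by simp
      have "(LINT \<omega>|M'. (G \<omega>)\<^sup>2) = (\<Sum>i\<in>{1..<m}. \<Sum>j\<in>{1..<m}. c i * c j * (LINT \<omega>|M'. \<xi> i \<omega> * \<xi> j \<omega>))"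
        unfolding G_def by (rule expectation_sum_square) (use i\<xi>\<xi> in auto)
      also have "\<dots> = (\<Sum>i\<in>{1..<m}. \<Sum>j\<in>{1..<m}. c i * c j * (LINT \<omega>|M0. \<psi> i (Wq \<omega>) * \<psi> j (Wq \<omega>)))"
        by (intro sum.cong refl) (use cov in \<open>simp add: E\<psi>\<psi> f_def\<close>)
      also have "\<dots> = (LINT \<omega>|M0. (\<phi> (Wq \<omega>))\<^sup>2)"
        unfolding \<phi>_def by (rule expectation_sum_square[symmetric]) (rule i\<psi>\<psi>)
      finally show "(LINT \<omega>|M'. (G \<omega>)\<^sup>2) = (LINT \<omega>|M0. (\<phi> (Wq \<omega>))\<^sup>2)" .
    qed
    moreover have "(\<Sum>k=1..N. \<phi> (Wqs k \<omega>)) / sqrt (real N) = (\<Sum>i<m. c i * V N \<omega> i)" for N \<omega>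
    proof -
      have "(\<Sum>i<m. c i * V N \<omega> i) = (\<Sum>i\<in>{1..<m}. c i * V N \<omega> i)"
        by (rule drop0) (simp add: V_def)
      also have "\<dots> = (\<Sum>i\<in>{1..<m}. c i * ((\<Sum>k=1..N. \<psi> i (Wqs k \<omega>)) / sqrt (real N)))"
        by (intro sum.cong refl) (simp add: V)
      also have "\<dots> = (\<Sum>k=1..N. \<phi> (Wqs k \<omega>)) / sqrt (real N)"
        unfolding \<phi>_def by (subst sum.swap) (simp add: sum_distrib_left sum_divide_distrib)
      finally show ?thesis by simp
    qed
    moreover have "(LINT \<omega>|M'. cos (a + G \<omega>)) = (LINT \<omega>|M'. cos (a + (\<Sum>i<m. c i * Z \<omega> i)))"
    proof (rule integral_cong_AE)
      show "(\<lambda>\<omega>. cos (a + G \<omega>)) \<in> borel_measurable M'"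
        unfolding G_def using m\<xi> by (auto intro!: borel_measurable_sum borel_measurable_add borel_measurable_times)
      show "(\<lambda>\<omega>. cos (a + (\<Sum>i<m. c i * Z \<omega> i))) \<in> borel_measurable M'" using mZ by simp
      show "AE \<omega> in M'. cos (a + G \<omega>) = cos (a + (\<Sum>i<m. c i * Z \<omega> i))"
        using ZX
      proof eventually_elim
        case (elim \<omega>)
        have "(\<Sum>i<m. c i * Z \<omega> i) = G \<omega>"
          unfolding elim by (subst drop0) (auto simp: X_def G_def)
        then show ?case by simp
      qed
    qed
    ultimately show ?thesis by simp
  qed

  \<comment> \<open>Transfer along \<open>S\<close> to \<open>linf b\<close>\<close>
  define Y where "Y = (\<lambda>\<omega>. (S_op q (Z \<omega>))(0 := 0))"
  interpret L: Metric_space "linf b" "linf_dist b" by (rule Metric_space_linf[OF b(1)])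
  \<comment> \<open>\<open>S\<close> has Lipschitz constant 1 for the two norms, so composition
    keeps \<open>L\<close>.\<close>
  have lip: "lipschitz_l1 w L (\<lambda>x. h ((S_op q x)(0 := 0)))"
    if L: "L \<ge> 0" and h: "\<And>x y. x \<in> linf b \<Longrightarrow> y \<in> linf b \<Longrightarrow> \<bar>h x - h y\<bar> \<le> L * linf_dist b x y"
    for h :: "(nat \<Rightarrow> real) \<Rightarrow> real" and L
    unfolding lipschitz_l1_def
  proof (intro conjI ballI L)
    fix x y assume xy: "x \<in> weighted_l1 w" "y \<in> weighted_l1 w"
    have "linf_dist b ((S_op q x)(0 := 0)) ((S_op q y)(0 := 0)) \<le> (\<Sum>s. w s * \<bar>x s - y s\<bar>)"
      unfolding w_def by (rule linf_dist_S_op_le[OF q b(1) less_imp_le[OF b(2)] xy[unfolded w_def]])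
    then show "\<bar>h ((S_op q x)(0 := 0)) - h ((S_op q y)(0 := 0))\<bar> \<le> L * (\<Sum>s. w s * \<bar>x s - y s\<bar>)"
      using h[OF S_linf[OF xy(1)] S_linf[OF xy(2)]] L by (meson mult_left_mono order_trans)
  qed
  have "tends_in_distribution L.mtopology M (\<lambda>N \<omega>. (S_op q (V N \<omega>))(0 := 0)) M' Y"
  proof (rule L.tends_in_distribution_if_lipschitz[OF M M'])
    show "(\<lambda>\<omega>. (S_op q (V N \<omega>))(0 := 0)) \<in> space M \<rightarrow> linf b" for N
      using S_linf[OF lV] by simp
    show "Y \<in> space M' \<rightarrow> linf b" using S_linf[OF lZ] by (simp add: Y_def)
    fix h :: "(nat \<Rightarrow> real) \<Rightarrow> real" and L B
    assume L: "L \<ge> 0" and h: "\<And>x y. x \<in> linf b \<Longrightarrow> y \<in> linf b \<Longrightarrow> \<bar>h x - h y\<bar> \<le> L * linf_dist b x y"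
      and hB: "\<And>x. x \<in> linf b \<Longrightarrow> \<bar>h x\<bar> \<le> B"
    note H = lip[OF L h]
    show "(\<lambda>\<omega>. h ((S_op q (V N \<omega>))(0 := 0))) \<in> borel_measurable M" for N
      by (rule measurable_lipschitz_l1(2)[OF H mV lV])
    show "(\<lambda>\<omega>. h (Y \<omega>)) \<in> borel_measurable M'"
      unfolding Y_def by (rule measurable_lipschitz_l1(2)[OF H mZ lZ])
    show "(\<lambda>N. LINT \<omega>|M. h ((S_op q (V N \<omega>))(0 := 0))) \<longlonglongrightarrow> (LINT \<omega>|M'. h (Y \<omega>))"
      unfolding Y_def
      by (rule weighted_l1_convergence[where B = B, OF M M' w \<sigma>(1) w\<sigma> mV mZ lV lZ sqV sqZ chars H])
        (use hB S_linf in auto)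
  qed
  then have tends: "tends_in_distribution (linf_top b)
      M (\<lambda>N \<omega>. (\<lambda>w. sqrt (real N) * (S_op q (emp_pmf Wqs N \<omega>) w - pmass M0 W w))(0 := 0)) M' Y"
    unfolding linf_top_def SV .
  have AEl: "AE \<omega> in M'. X \<omega> \<in> weighted_l1 w \<and> Z \<omega> = X \<omega>"
    using ZX AE_space by eventually_elim (use lZ in force)
  have "AE \<omega> in M'. \<forall>n\<ge>1. summable (S_term q (\<lambda>s. \<xi> s \<omega>) n)"
    using AEl
  proof eventually_elim
    case (elim \<omega>)
    show ?case
    proof (intro allI impI)
      fix n :: nat assume "n \<ge> 1"
      then have "S_term q (\<lambda>s. \<xi> s \<omega>) n = S_term q (X \<omega>) n"
        by (simp add: S_term_def X_def fun_eq_iff)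
      then show "summable (S_term q (\<lambda>s. \<xi> s \<omega>) n)" using S_summable elim by simp
    qed
  qed
  moreover have "AE \<omega> in M'. Y \<omega> = (S_op q (\<lambda>s. \<xi> s \<omega>))(0 := 0)"
    using AEl
  proof eventually_elim
    case (elim \<omega>)
    have "S_op q (X \<omega>) n = S_op q (\<lambda>s. \<xi> s \<omega>) n" if "n \<ge> 1" for n
      by (rule S_op_cong) (use that in \<open>simp add: X_def\<close>)
    then show ?case using elim by (intro ext) (simp add: Y_def Suc_le_eq)
  qed
  ultimately show ?thesis using tends by blast
qed

end
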